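(* Let $X$ be a standard Borel space equipped with a non-zero non-atomic measure $\mu$ that is either finite or sigma-finite. Then the group $\mathrm{Aut}(X,\mu)_u$, that is, the group $\mathrm{Aut}(X,\mu)$ of all $\mu$-preserving automorphisms of $(X,\mu)$ equipped with the uniform topology, is not amenable.
   Context: $\mathrm{Aut}(X,\mu)$ is the group of all $\mu$-preserving Borel automorphisms of $X$, where two automorphisms that agree $\mu$-almost everywhere are identified. If $\mu$ is a probability measure, the uniform topology on $\mathrm{Aut}(X,\mu)$ is the group topology determined by the metric $d_u(T,S)=\mu(\{x\in X : T(x)\neq S(x)\})$. For a general non-zero sigma-finite $\mu$, the uniform topology is the group topology determined by the metric $d_u(T,S)=\nu(\{x\in X : T(x)\neq S(x)\})$, where $\nu$ is a probability measure equivalent to $\mu$ (i.e. having the same null sets); the topology does not depend on the choice of $\nu$. A topological group $G$ is amenable if every continuous affine action of $G$ on a non-empty compact convex subset of a locally convex Hausdorff topological vector space has a fixed point; equivalently, if there is a left-invariant mean on the space of bounded right uniformly continuous functions on $G$. *)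

theory Defs
  imports "HOL-Probability.Probability" "HOL-Algebra.Group_Action" "HOL-Algebra.Module"
begin

section \<open>Standard Borel spaces and non-atomic measures\<close>

definition standard_borel :: "'a measure \<Rightarrow> bool" where
  "standard_borel M \<longleftrightarrow>
     (\<exists>T. topspace T = space M \<and> completely_metrizable_space T \<and> second_countable T \<and>
          sets M = sigma_sets (space M) {U. openin T U})"

definition nonatomic :: "'a measure \<Rightarrow> bool" where
  "nonatomic M \<longleftrightarrow>
     (\<forall>A \<in> sets M. 0 < emeasure M A \<longrightarrow>
        (\<exists>B \<in> sets M. B \<subseteq> A \<and> 0 < emeasure M B \<and> emeasure M B < emeasure M A))"


section \<open>The group of measure-preserving automorphisms\<close>

text \<open>Elements of \<^term>\<open>Bij (space M)\<close> are extensional, so that a Borel automorphism is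
  determined by its values on \<^term>\<open>space M\<close>.\<close>

definition borel_automorphisms :: "'a measure \<Rightarrow> ('a \<Rightarrow> 'a) set" where
  "borel_automorphisms M =
     {f \<in> Bij (space M). f \<in> measurable M M \<and> inv_into (space M) f \<in> measurable M M \<and>
                         distr M M f = M}"

definition ae_eq :: "'a measure \<Rightarrow> (('a \<Rightarrow> 'a) \<times> ('a \<Rightarrow> 'a)) set" where
  "ae_eq M = {(f, g) \<in> borel_automorphisms M \<times> borel_automorphisms M. AE x in M. f x = g x}"

definition Aut :: "'a measure \<Rightarrow> ('a \<Rightarrow> 'a) set monoid" where
  "Aut M = \<lparr>carrier = borel_automorphisms M // ae_eq M,
            mult = (\<lambda>S T. \<Union>f\<in>S. \<Union>g\<in>T. ae_eq M `` {compose (space M) f g}),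
            one = ae_eq M `` {\<lambda>x\<in>space M. x}\<rparr>"

text \<open>The value of the metric does not depend on the chosen representatives when
  \<^term>\<open>\<nu>\<close> and \<^term>\<open>M\<close> have the same null sets.\<close>

definition uniform_dist :: "'a measure \<Rightarrow> ('a \<Rightarrow> 'a) set \<Rightarrow> ('a \<Rightarrow> 'a) set \<Rightarrow> real" where
  "uniform_dist \<nu> S T = measure \<nu> {x \<in> space \<nu>. (SOME f. f \<in> S) x \<noteq> (SOME g. g \<in> T) x}"

definition equivalent_prob :: "'a measure \<Rightarrow> 'a measure \<Rightarrow> bool" where
  "equivalent_prob M \<nu> \<longleftrightarrow> prob_space \<nu> \<and> sets \<nu> = sets M \<and> null_sets \<nu> = null_sets M"

definition uniform_topology :: "'a measure \<Rightarrow> 'a measure \<Rightarrow> ('a \<Rightarrow> 'a) set topology" where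
  "uniform_topology M \<nu> = Metric_space.mtopology (carrier (Aut M)) (uniform_dist \<nu>)"


section \<open>Amenable topological groups\<close>

definition real_ring :: "real ring" where
  "real_ring = \<lparr>carrier = UNIV, mult = (*), one = 1, ring.zero = 0, add = (+)\<rparr>"

definition convex_in :: "(real, 'v) module \<Rightarrow> 'v set \<Rightarrow> bool" where
  "convex_in V K \<longleftrightarrow>
     K \<subseteq> carrier V \<and>
     (\<forall>x\<in>K. \<forall>y\<in>K. \<forall>t\<in>{0..1}. (1 - t) \<odot>\<^bsub>V\<^esub> x \<oplus>\<^bsub>V\<^esub> t \<odot>\<^bsub>V\<^esub> y \<in> K)"

definition locally_convex_Hausdorff_tvs :: "(real, 'v) module \<Rightarrow> 'v topology \<Rightarrow> bool" where
  "locally_convex_Hausdorff_tvs V \<tau> \<longleftrightarrow>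
     module real_ring V \<and> topspace \<tau> = carrier V \<and>
     continuous_map (prod_topology \<tau> \<tau>) \<tau> (\<lambda>(x, y). x \<oplus>\<^bsub>V\<^esub> y) \<and>
     continuous_map (prod_topology euclideanreal \<tau>) \<tau> (\<lambda>(a, x). a \<odot>\<^bsub>V\<^esub> x) \<and>
     Hausdorff_space \<tau> \<and>
     (\<forall>U. openin \<tau> U \<and> \<zero>\<^bsub>V\<^esub> \<in> U \<longrightarrow>
        (\<exists>W. openin \<tau> W \<and> \<zero>\<^bsub>V\<^esub> \<in> W \<and> W \<subseteq> U \<and> convex_in V W))"

definition continuous_affine_action ::
    "'g monoid \<Rightarrow> 'g topology \<Rightarrow> (real, 'v) module \<Rightarrow> 'v topology \<Rightarrow> 'v set \<Rightarrow>
     ('g \<Rightarrow> 'v \<Rightarrow> 'v) \<Rightarrow> bool" where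
  "continuous_affine_action G T V \<tau> K \<phi> \<longleftrightarrow>
     group_action G K \<phi> \<and>
     (\<forall>g\<in>carrier G. \<forall>x\<in>K. \<forall>y\<in>K. \<forall>t\<in>{0..1}.
        \<phi> g ((1 - t) \<odot>\<^bsub>V\<^esub> x \<oplus>\<^bsub>V\<^esub> t \<odot>\<^bsub>V\<^esub> y)
          = (1 - t) \<odot>\<^bsub>V\<^esub> \<phi> g x \<oplus>\<^bsub>V\<^esub> t \<odot>\<^bsub>V\<^esub> \<phi> g y) \<and>
     continuous_map (prod_topology T (subtopology \<tau> K)) (subtopology \<tau> K) (\<lambda>(g, x). \<phi> g x)"

text \<open>HOL cannot quantify over all types inside a formula, so the locally convex spaces range
  over those whose carrier is a set of elements of \<^typ>\<open>('g \<Rightarrow> real) \<Rightarrow> real\<close>, with arbitrary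
  vector space operations and topology. This loses nothing: the set of means on the bounded
  right uniformly continuous functions on \<^term>\<open>G\<close>, with the weak* topology and the translation
  action, is such a compact convex set, and a fixed point in it is a left-invariant mean, which
  yields fixed points for all other actions, whatever the underlying type. In particular,
  failure of this property exhibits a fixed-point free action in the usual sense.\<close>

definition amenable :: "'g monoid \<Rightarrow> 'g topology \<Rightarrow> bool" where
  "amenable G T \<longleftrightarrow>
     (\<forall>(V :: (real, ('g \<Rightarrow> real) \<Rightarrow> real) module) \<tau> K \<phi>.
        locally_convex_Hausdorff_tvs V \<tau> \<and> K \<noteq> {} \<and> compactin \<tau> K \<and> convex_in V K \<and>
        continuous_affine_action G T V \<tau> K \<phi> \<longrightarrow>
        (\<exists>x\<in>K. \<forall>g\<in>carrier G. \<phi> g x = x))"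

end

theory Submission
  imports Defs
begin

text \<open>
  Let \<open>\<Gamma>\<close> be a countable group of permutations of the natural numbers that admits no invariant
  mean, and let it act on \<open>\<real>\<^sup>\<nat>\<close>, with an i.i.d. non-atomic product measure, by permuting coordinates;
  this action is measure preserving and essentially free. Since non-atomic standard probability
  spaces are isomorphic, the action is transported to a subset \<open>X\<close> of the given space, of positive
  finite measure.

  The graphs of the maps \<open>g\<^sup>-\<^sup>1\<close> on \<open>X\<close> can be cut, modulo null sets, into pieces taken from a maximal
  family of partial maps whose \<open>\<Gamma>\<close>-translates are pairwise a.e. disjoint (Zorn's lemma). So for
  every automorphism \<open>g\<close> and almost every \<open>x\<close> there is a unique \<open>\<sigma> \<in> \<Gamma>\<close> for which \<open>g\<^sup>-\<^sup>1 x = f (\<sigma> x)\<close>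
  with \<open>f\<close> in the family. The distribution of \<open>\<sigma>\<close> as \<open>x\<close> varies is a probability measure on \<open>\<Gamma>\<close> which
  depends equivariantly on \<open>g\<close>, and changing \<open>g\<close> on a small set changes it only slightly: it is
  uniformly continuous for the uniform topology. Hence an invariant mean on the bounded uniformly
  continuous functions on the group would produce a \<open>\<Gamma>\<close>-invariant mean.
\<close>

section \<open>Borel coding of standard Borel spaces by reals\<close>

text \<open>A copy of a non-amenable group inside the automorphism group is no contradiction by
  itself, since amenability of topological groups does not pass to arbitrary subgroups. In a
  discrete group one would choose a transversal of the cosets and read off the coordinate in the
  subgroup. The maximal family is a measurable substitute for such a transversal, applied point by
  point, and so it yields a random element of \<Gamma> instead of a single one. The uniform topology
  enters because, up to null sets, the label at a point depends only on the value of the inverse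
  automorphism at that point. The random permutation is evaluated at one fixed number, which gives a
  finitely additive probability on \<nat>. Invariance under an involution and under a permutation of
  order 3 would force the multiples of 3 to have mass both 1/2 and 1/3.\<close>

lemma digit_expansion:
  fixes b :: "nat \<Rightarrow> bool"
  assumes e_def: "e = (\<lambda>b::nat \<Rightarrow> bool. \<Sum>n. (if b n then 2 else 0) / 3 ^ Suc n :: real)"
  shows "e b = ((if b 0 then 2 else 0) + e (\<lambda>n. b (Suc n))) / 3"
    and "0 \<le> e b" and "e b \<le> 1"
proof -
  let ?f = "\<lambda>b n. (if b n then 2 else 0) / 3 ^ Suc n :: real"
  have geo: "(\<lambda>n. 2 / 3 ^ Suc n :: real) sums 1"
    using sums_mult[OF geometric_sums[of "1/3::real"], of "2/3"]
    by (simp add: power_divide)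
  have summ: "summable (?f b)" for b
    by (rule summable_comparison_test'[OF sums_summable[OF geo], of 0]) auto
  show "0 \<le> e b"
    unfolding e_def by (rule suminf_nonneg[OF summ]) auto
  show "e b \<le> 1"
    unfolding e_def sums_unique[OF geo] by (rule suminf_le[OF _ summ sums_summable[OF geo]]) auto
  have "e b = ?f b 0 + (\<Sum>n. ?f b (Suc n))"
    unfolding e_def using suminf_split_head[OF summ, of b] by simp
  also have "(\<lambda>n. ?f b (Suc n)) = (\<lambda>n. ?f (\<lambda>n. b (Suc n)) n / 3)"
    by auto
  also have "(\<Sum>n. ?f (\<lambda>n. b (Suc n)) n / 3) = e (\<lambda>n. b (Suc n)) / 3"
    unfolding e_def by (rule suminf_divide[OF summ])
  finally show "e b = ((if b 0 then 2 else 0) + e (\<lambda>n. b (Suc n))) / 3"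
    by (simp add: add_divide_distrib)
qed

text \<open>The Cantor embedding, with its digits recovered by a greedy algorithm.\<close>

lemma measurable_binary_coding:
  obtains e :: "(nat \<Rightarrow> bool) \<Rightarrow> real" and d :: "nat \<Rightarrow> real \<Rightarrow> bool"
  where "\<And>b n. d n (e b) = b n" "\<And>n. Measurable.pred borel (d n)"
    "\<And>(M :: 'a measure) b. (\<And>n. Measurable.pred M (\<lambda>x. b x n)) \<Longrightarrow> (\<lambda>x. e (b x)) \<in> borel_measurable M"
proof -
  define e where "e = (\<lambda>b::nat \<Rightarrow> bool. \<Sum>n. (if b n then 2 else 0) / 3 ^ Suc n :: real)"
  note exp = digit_expansion[OF e_def]
  \<comment> \<open>On Cantor codes, \<open>r\<close> deletes the leading ternary digit.\<close>
  define r where "r = (\<lambda>y::real. 3 * y - (if y > 1/2 then 2 else 0))"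
  \<comment> \<open>The digits are 0 and 2: codes with first digit 0 lie in [0, 1/3], the others in
    [2/3, 1], and 1/2 lies in the gap.\<close>
  have dig: "e b > 1/2 \<longleftrightarrow> b 0" for b
    using exp(1)[of b] exp(2,3)[of "\<lambda>n. b (Suc n)"] by (auto split: if_splits)
  have "r (e b) = e (\<lambda>n. b (Suc n))" for b
    using exp(1)[of b] unfolding r_def dig by (auto split: if_splits)
  then have iter: "(r ^^ n) (e b) = e (\<lambda>k. b (n + k))" for n b
    by (induction n) auto
  have r_meas[measurable]: "r \<in> borel_measurable borel"
    unfolding r_def by measurable
  have "(r ^^ n) \<in> borel_measurable borel" for n
    by (induction n) (auto intro: measurable_comp[OF _ r_meas])
  note [measurable] = this
  show thesis
  proof (rule that[of "\<lambda>n y. (r ^^ n) y > 1/2" e])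
    show "(1/2 < (r ^^ n) (e b)) = b n" for b n
      unfolding iter dig by simp
    show "Measurable.pred borel (\<lambda>y. (r ^^ n) y > 1/2)" for n
      by measurable
    fix M :: "'a measure" and b :: "'a \<Rightarrow> nat \<Rightarrow> bool"
    assume [measurable]: "\<And>n. Measurable.pred M (\<lambda>x. b x n)"
    show "(\<lambda>x. e (b x)) \<in> borel_measurable M"
      unfolding e_def by measurable
  qed
qed

text \<open>The sets of basic open sets containing a common point are cut out by countably many
  conditions, so that the code of a point in the Cantor space has a Borel inverse.\<close>

lemma standard_borel_embedding:
  assumes std: "standard_borel M" and ne: "space M \<noteq> {}"
  obtains \<rho> :: "'a \<Rightarrow> real" and \<kappa> :: "real \<Rightarrow> 'a"
  where "\<rho> \<in> borel_measurable M" "\<kappa> \<in> measurable borel M" "\<And>x. x \<in> space M \<Longrightarrow> \<kappa> (\<rho> x) = x"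
proof -
  obtain T where T: "topspace T = space M" "completely_metrizable_space T" "second_countable T"
    "sets M = sigma_sets (space M) {U. openin T U}"
    using std unfolding standard_borel_def by blast
  obtain X d where "Metric_space X d" and compl: "Metric_space.mcomplete X d"
    and Td: "T = Metric_space.mtopology X d"
    using T(2) unfolding completely_metrizable_space_def by blast
  interpret Metric_space X d by fact
  have X: "space M = X"
    using T(1) Td by simp
  obtain \<B> where B: "countable \<B>" "\<And>V. V \<in> \<B> \<Longrightarrow> openin T V"
    "\<And>U x. openin T U \<Longrightarrow> x \<in> U \<Longrightarrow> \<exists>V\<in>\<B>. x \<in> V \<and> V \<subseteq> U"
    using T(3) unfolding second_countable_def by metis
  \<comment> \<open>The empty set makes the enumerated family non-empty. Its index is never selected
    by a good code: the second clause of \<open>good\<close> with n = m excludes it.\<close>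
  define U where "U = from_nat_into (insert {} \<B>)"
  have rU: "range U = insert {} \<B>"
    unfolding U_def using B(1) by (intro range_from_nat_into) auto
  have Uo: "openin T (U n)" for n
    using rU B(2) openin_empty by (metis insertE rangeI)
  have Ub: "\<exists>n. x \<in> U n \<and> U n \<subseteq> V" if "openin T V" "x \<in> V" for V x
    using B(3)[OF that] rU by (metis insertCI rangeE)
  have UX: "U n \<subseteq> X" for n
    using openin_subset[OF Uo, of n] T(1) X by simp
  have openM: "V \<in> sets M" if "openin T V" for V
    unfolding T(4) using that by auto
  obtain e :: "(nat \<Rightarrow> bool) \<Rightarrow> real" and dg :: "nat \<Rightarrow> real \<Rightarrow> bool"
    where dg: "\<And>b n. dg n (e b) = b n" and [measurable]: "\<And>n. Measurable.pred borel (dg n)"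
    and e: "\<And>(M :: 'a measure) b. (\<And>n. Measurable.pred M (\<lambda>x. b x n)) \<Longrightarrow> (\<lambda>x. e (b x)) \<in> borel_measurable M"
    using measurable_binary_coding by metis
  \<comment> \<open>The clauses ask for selected sets of arbitrarily small diameter, no two of them
    disjoint, each containing the closure of another, and for closure under larger basic sets. By
    completeness the selected sets are then exactly the basic neighbourhoods of one point. All
    quantifiers are countable, so the condition is Borel.\<close>
  define good where "good y \<longleftrightarrow>
      (\<forall>k::nat. \<exists>n. dg n y \<and> (\<forall>p\<in>U n. \<forall>q\<in>U n. d p q < 1 / Suc k)) \<and>
      (\<forall>n m. dg n y \<and> dg m y \<longrightarrow> U n \<inter> U m \<noteq> {}) \<and>
      (\<forall>n. dg n y \<longrightarrow> (\<exists>m. dg m y \<and> Abstract_Topology.closure_of T (U m) \<subseteq> U n)) \<and>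
      (\<forall>n m. dg n y \<and> U n \<subseteq> U m \<longrightarrow> dg m y)" for y
  have good_meas[measurable]: "Measurable.pred borel good"
    unfolding good_def by measurable
  have small: "\<exists>n. x \<in> U n \<and> (\<forall>p\<in>U n. \<forall>q\<in>U n. d p q < \<epsilon>)" if "x \<in> X" "\<epsilon> > 0" for x \<epsilon>
  proof -
    have "openin T (mball x (\<epsilon>/2))" "x \<in> mball x (\<epsilon>/2)"
      using that unfolding Td by auto
    then obtain n where n: "x \<in> U n" "U n \<subseteq> mball x (\<epsilon>/2)"
      using Ub by blast
    have "d p q < \<epsilon>" if "p \<in> U n" "q \<in> U n" for p q
    proof -
      have "p \<in> X" "q \<in> X" "d x p < \<epsilon>/2" "d x q < \<epsilon>/2"
        using that n(2) by auto
      then show ?thesis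
        using triangle[of p x q] \<open>x \<in> X\<close> by (simp add: commute)
    qed
    with n(1) show ?thesis by blast
  qed
  have point: "\<exists>x\<in>X. \<forall>n. dg n y = (x \<in> U n)" if "good y" for y
  proof -
    have g1: "\<exists>n. dg n y \<and> (\<forall>p\<in>U n. \<forall>q\<in>U n. d p q < 1 / Suc k)"
      and g2: "dg n y \<Longrightarrow> dg m y \<Longrightarrow> U n \<inter> U m \<noteq> {}"
      and g3: "dg n y \<Longrightarrow> \<exists>m. dg m y \<and> Abstract_Topology.closure_of T (U m) \<subseteq> U n"
      and g4: "dg n y \<Longrightarrow> U n \<subseteq> U m \<Longrightarrow> dg m y" for k n m
      using that unfolding good_def by blast+
    obtain N where N: "\<And>k. dg (N k) y" "\<And>k p q. p \<in> U (N k) \<Longrightarrow> q \<in> U (N k) \<Longrightarrow> d p q < 1 / Suc k"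
      using g1 by metis
    have "\<exists>p. p \<in> U (N k)" for k
      using g2[OF N(1) N(1), of k k] by auto
    then obtain p where p: "\<And>k. p k \<in> U (N k)" by metis
    have pX: "p k \<in> X" for k using p UX by blast
    have dist: "d (p k) q < 1 / Suc k + 1 / Suc l" if "q \<in> U (N l)" for k l q
    proof -
      obtain z where z: "z \<in> U (N k)" "z \<in> U (N l)"
        using g2[OF N(1) N(1), of k l] by auto
      have "d (p k) q \<le> d (p k) z + d z q"
        using pX z that UX by (intro triangle) auto
      also have "\<dots> < 1 / Suc k + 1 / Suc l"
        using N(2)[OF p z(1)] N(2)[OF z(2) that] by simp
      finally show ?thesis .
    qed
    have "MCauchy p"
      unfolding MCauchy_def
    proof (intro conjI allI impI)
      show "range p \<subseteq> X" using pX by auto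
      fix \<epsilon> :: real assume "\<epsilon> > 0"
      then obtain K :: nat where K: "1 / Suc K < \<epsilon>/2"
        using nat_approx_posE[of "\<epsilon>/2"] by auto
      have "d (p n) (p n') < \<epsilon>" if "K \<le> n" "K \<le> n'" for n n'
      proof -
        have "1 / Suc n \<le> 1 / Suc K" "1 / Suc n' \<le> 1 / Suc K"
          using that by (auto simp: field_simps)
        then show ?thesis using dist[OF p, of n n'] K by linarith
      qed
      then show "\<exists>N. \<forall>n n'. N \<le> n \<longrightarrow> N \<le> n' \<longrightarrow> d (p n) (p n') < \<epsilon>" by blast
    qed
    then obtain x where x: "limitin mtopology p x sequentially"
      using compl unfolding mcomplete_def by blast
    then have xX: "x \<in> X" by (simp add: limitin_mspace)
    have px: "d (p k) x \<le> 1 / Suc k" for k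
    proof (rule field_le_epsilon)
      fix \<epsilon> :: real assume "\<epsilon> > 0"
      obtain L0 :: nat where L0: "1 / Suc L0 < \<epsilon>/2"
        using nat_approx_posE[of "\<epsilon>/2"] \<open>\<epsilon> > 0\<close> by auto
      obtain L where L: "\<And>n. n \<ge> L \<Longrightarrow> d (p n) x < \<epsilon>/2"
        using x \<open>\<epsilon> > 0\<close> unfolding limit_metric_sequentially by (metis half_gt_zero)
      let ?l = "max L L0"
      have "1 / Suc ?l \<le> 1 / Suc L0" by (auto simp: field_simps)
      moreover have "d (p k) x \<le> d (p k) (p ?l) + d (p ?l) x"
        using pX xX by (intro triangle) auto
      ultimately show "d (p k) x \<le> 1 / Suc k + \<epsilon>"
        using dist[OF p, of k ?l] L[of ?l] L0 by simp
    qed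
    have close: "d x q < 2 / Suc k" if "q \<in> U (N k)" for q k
    proof -
      have "d x q \<le> d (p k) x + d (p k) q"
        using pX xX that UX triangle[of x "p k" q] by (auto simp: commute)
      also have "\<dots> < 1 / Suc k + 1 / Suc k"
        using px[of k] N(2)[OF p that] by linarith
      finally show ?thesis by simp
    qed
    \<comment> \<open>The limit is adherent to every selected set; the third clause of
      \<open>good\<close> upgrades this to membership.\<close>
    have clos: "x \<in> Abstract_Topology.closure_of T (U n)" if dgn: "dg n y" for n
      unfolding Td metric_closure_of
    proof (intro CollectI conjI allI impI xX)
      fix r :: real assume "r > 0"
      then obtain k :: nat where k: "1 / Suc k < r/2"
        using nat_approx_posE[of "r/2"] by auto
      obtain q where q: "q \<in> U n" "q \<in> U (N k)"
        using g2[OF dgn N(1)[of k]] by auto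
      have "d x q < r" using close[OF q(2)] k by simp
      then show "\<exists>y\<in>U n. y \<in> mball x r" using q(1) UX xX by auto
    qed
    have "dg n y = (x \<in> U n)" for n
    proof
      assume "dg n y" then show "x \<in> U n" using g3 clos by blast
    next
      assume "x \<in> U n"
      then obtain r where r: "r > 0" "mball x r \<subseteq> U n"
        using Uo[of n] unfolding Td openin_mtopology by blast
      then obtain k :: nat where k: "1 / Suc k < r/2"
        using nat_approx_posE[of "r/2"] by auto
      have "U (N k) \<subseteq> mball x r"
        using close[of _ k] k UX xX by force
      then show "dg n y" using g4[OF N(1)[of k]] r(2) by blast
    qed
    then show ?thesis using xX by blast
  qed
  define \<rho> where "\<rho> = (\<lambda>x. e (\<lambda>n. x \<in> U n))"
  have good_\<rho>: "good (\<rho> x)" if "x \<in> X" for x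
    unfolding good_def \<rho>_def dg
  proof (intro conjI allI impI)
    show "\<exists>n. x \<in> U n \<and> (\<forall>p\<in>U n. \<forall>q\<in>U n. d p q < 1 / Suc k)" for k
      using small[OF that] by simp
    show "U n \<inter> U m \<noteq> {}" if "x \<in> U n \<and> x \<in> U m" for n m
      using that by blast
    show "x \<in> U m" if "x \<in> U n \<and> U n \<subseteq> U m" for n m
      using that by blast
    fix n assume "x \<in> U n"
    then obtain r where r: "r > 0" "mcball x r \<subseteq> U n"
      using Uo[of n] unfolding Td openin_mtopology_mcball by blast
    then obtain m where m: "x \<in> U m" "U m \<subseteq> mball x r"
      using Ub[of "mball x r" x] \<open>x \<in> X\<close> unfolding Td by auto
    have "Abstract_Topology.closure_of T (U m) \<subseteq> mcball x r"
      using m(2) mball_subset_mcball[of x r] unfolding Td by (intro closure_of_minimal) auto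
    then show "\<exists>m. x \<in> U m \<and> Abstract_Topology.closure_of T (U m) \<subseteq> U n" using m r by blast
  qed
  have unique: "x = x'" if xx: "x \<in> X" "x' \<in> X" "\<And>n. x \<in> U n \<longleftrightarrow> x' \<in> U n" for x x'
  proof (rule ccontr)
    assume "x \<noteq> x'"
    then have "d x x' > 0" using xx by simp
    then obtain n where n: "x \<in> U n" "\<forall>p\<in>U n. \<forall>q\<in>U n. d p q < d x x'"
      using small[OF xx(1)] by blast
    then have "d x x' < d x x'" using xx(3)[of n] by blast
    then show False by simp
  qed
  define \<kappa> where "\<kappa> y = (if good y then THE x. x \<in> X \<and> (\<forall>n. dg n y = (x \<in> U n)) else (SOME x. x \<in> X))" for y
  have \<kappa>: "\<kappa> y \<in> X" "dg n y = (\<kappa> y \<in> U n)" if "good y" for y n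
  proof -
    have "\<exists>!x. x \<in> X \<and> (\<forall>n. dg n y = (x \<in> U n))"
    proof (rule ex_ex1I)
      show "\<exists>x. x \<in> X \<and> (\<forall>n. dg n y = (x \<in> U n))"
        using point[OF that] by blast
    next
      fix x x' assume "x \<in> X \<and> (\<forall>n. dg n y = (x \<in> U n))" "x' \<in> X \<and> (\<forall>n. dg n y = (x' \<in> U n))"
      then show "x = x'" by (intro unique) auto
    qed
    from theI'[OF this] have "\<kappa> y \<in> X \<and> (\<forall>n. dg n y = (\<kappa> y \<in> U n))"
      unfolding \<kappa>_def if_P[OF that] .
    then show "\<kappa> y \<in> X" "dg n y = (\<kappa> y \<in> U n)"
      by blast+
  qed
  have bad: "\<kappa> y = (SOME x. x \<in> X)" if "\<not> good y" for y
    using that unfolding \<kappa>_def by simp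
  have x0: "(SOME x. x \<in> X) \<in> X"
    using ne X by (simp add: some_in_eq)
  show thesis
  proof
    show "\<rho> \<in> borel_measurable M"
      unfolding \<rho>_def
    proof (rule e)
      show "Measurable.pred M (\<lambda>x. x \<in> U n)" for n
        using openM[OF Uo[of n]] by measurable
    qed
    show "\<kappa> (\<rho> x) = x" if "x \<in> space M" for x
    proof (rule unique)
      have g: "good (\<rho> x)" using good_\<rho> that X by simp
      show "\<kappa> (\<rho> x) \<in> X" using \<kappa>(1)[OF g] .
      show "x \<in> X" using that X by simp
      show "(\<kappa> (\<rho> x) \<in> U n) = (x \<in> U n)" for n
        using \<kappa>(2)[OF g, of n] unfolding \<rho>_def dg by simp
    qed
    show "\<kappa> \<in> measurable borel M"
    proof (rule measurable_sigma_sets[OF T(4)])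
      show "{U. openin T U} \<subseteq> Pow (space M)"
        using openin_subset T(1) by fastforce
      show "\<kappa> \<in> space borel \<rightarrow> space M"
        using \<kappa>(1) bad x0 X by (metis Pi_I)
      fix V assume "V \<in> {U. openin T U}"
      then have V: "openin T V" by simp
      \<comment> \<open>On codes that are not good, \<open>\<kappa>\<close> is constant, so they
        contribute all or nothing.\<close>
      have "\<kappa> -` V \<inter> space borel =
          {y. good y \<and> (\<exists>n\<in>{n. U n \<subseteq> V}. dg n y) \<or> \<not> good y \<and> (SOME x. x \<in> X) \<in> V}"
      proof (rule Set.set_eqI)
        fix y
        have "\<kappa> y \<in> V \<longleftrightarrow> (\<exists>n\<in>{n. U n \<subseteq> V}. dg n y)" if "good y"
          using Ub[OF V] \<kappa>(2)[OF that] by blast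
        then show "y \<in> \<kappa> -` V \<inter> space borel \<longleftrightarrow> y \<in> {y. good y \<and> (\<exists>n\<in>{n. U n \<subseteq> V}. dg n y) \<or> \<not> good y \<and> (SOME x. x \<in> X) \<in> V}"
          using bad[of y] by (cases "good y") auto
      qed
      also have "\<dots> \<in> sets borel" by measurable
      finally show "\<kappa> -` V \<inter> space borel \<in> sets borel" .
    qed
  qed
qed

section \<open>Isomorphism of non-atomic standard probability spaces\<close>

text \<open>Asking for only one composite to be the identity almost everywhere keeps composition
  easy; \<open>ae_iso_sym\<close> recovers the other one.\<close>

definition ae_iso :: "'a measure \<Rightarrow> 'b measure \<Rightarrow> ('a \<Rightarrow> 'b) \<Rightarrow> ('b \<Rightarrow> 'a) \<Rightarrow> bool" where
  "ae_iso M N f g \<longleftrightarrow> f \<in> measurable M N \<and> g \<in> measurable N M \<and> distr M N f = N \<and>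
     (AE x in M. g (f x) = x)"

lemma ae_iso_trans:
  assumes "ae_iso M N f g" "ae_iso N L f' g'"
  shows "ae_iso M L (f' \<circ> f) (g \<circ> g')"
proof -
  note [measurable] = assms[unfolded ae_iso_def, THEN conjunct1]
    assms[unfolded ae_iso_def, THEN conjunct2, THEN conjunct1]
  have d: "distr M N f = N" "distr N L f' = L"
    and ae: "AE x in M. g (f x) = x" "AE y in N. g' (f' y) = y"
    using assms unfolding ae_iso_def by auto
  have "AE y in distr M N f. g' (f' y) = y"
    unfolding d(1) by (rule ae(2))
  then have "AE x in M. g' (f' (f x)) = f x"
    by (rule AE_distrD[rotated]) measurable
  then have "AE x in M. (g \<circ> g') ((f' \<circ> f) x) = x"
    using ae(1) by eventually_elim simp
  moreover have "L = distr M L (f' \<circ> f)"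
    using distr_distr[of f' N L f M] unfolding d by simp
  ultimately show ?thesis
    unfolding ae_iso_def by (auto intro: measurable_comp)
qed

text \<open>As N is the image of M under f, its image under g is the law of g \<circ> f, which is M.
  The identity f (g y) = y holds at y = f x whenever g (f x) = x, and measurability of the set where
  it holds carries it over from M to N.\<close>

lemma ae_iso_sym:
  assumes iso: "ae_iso M N f g" and diag: "{y \<in> space N. f (g y) = y} \<in> sets N"
  shows "ae_iso N M g f"
proof -
  have m[measurable]: "f \<in> measurable M N" "g \<in> measurable N M"
    and d: "distr M N f = N" and ae: "AE x in M. g (f x) = x"
    using iso unfolding ae_iso_def by auto
  have "distr N M g = distr M M (g \<circ> f)"
    using distr_distr[OF m(2,1)] unfolding d .
  also have "\<dots> = distr M M (\<lambda>x. x)"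
    using ae by (intro distr_cong_AE) auto
  finally have "distr N M g = M"
    by (simp add: distr_id2)
  moreover have "AE x in M. f (g (f x)) = f x"
    using ae by eventually_elim simp
  then have "AE y in distr M N f. f (g y) = y"
    using diag by (subst AE_distr_iff) auto
  then have "AE y in N. f (g y) = y"
    unfolding d .
  ultimately show ?thesis
    unfolding ae_iso_def using m by blast
qed

abbreviation uniform01 :: "real measure" where
  "uniform01 \<equiv> uniform_measure lborel {0<..<1}"

lemma prob_space_uniform01: "prob_space uniform01"
  by (rule prob_space_uniform_measure) auto

text \<open>The quantile function \<open>I\<close> sends the uniform law to N. Without atoms the
  distribution function \<open>C\<close> is continuous, and then it inverts \<open>I\<close> on the
  unit interval.\<close>

lemma ae_iso_uniform01:
  fixes N :: "real measure"
  assumes prob: "prob_space N" and sets: "sets N = sets borel" and null: "\<And>y. measure N {y} = 0"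
  obtains f g where "ae_iso uniform01 N f g"
proof -
  interpret prob_space N by fact
  interpret cdf_distribution N
    using sets sets_eq_imp_space_eq[OF sets]
    by (simp add: cdf_distribution_def real_distribution_def real_distribution_axioms_def prob)
  \<comment> \<open>\<open>I\<close> is controlled on the open unit interval; extending it by a
    constant gives a Borel function on the line.\<close>
  define J where "J = (\<lambda>\<omega>::real. if \<omega> \<in> {0<..<1} then I \<omega> else 0)"
  have [measurable]: "J \<in> borel_measurable borel"
    unfolding J_def
    using measurable_CI by (subst (asm) measurable_restrict_space_iff) auto
  have "emeasure (distr uniform01 borel J) A = emeasure N A" if "A \<in> sets borel" for A
  proof -
    have [measurable]: "A \<in> sets borel" by fact
    have "emeasure (distr uniform01 borel J) A = emeasure lborel ({0<..<1} \<inter> J -` A)"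
      using measurable_sets[OF \<open>J \<in> borel_measurable borel\<close> that]
      by (simp add: emeasure_distr divide_ennreal_def)
    also have "{0<..<1} \<inter> J -` A = I -` A \<inter> {0<..<1}"
      by (auto simp: J_def)
    also have "emeasure lborel \<dots> = emeasure (restrict_space lborel {0<..<1}) (I -` A \<inter> {0<..<1})"
      by (subst emeasure_restrict_space) auto
    also have "\<dots> = emeasure (distr (restrict_space lborel {0<..<1}) borel I) A"
      by (subst emeasure_distr) (auto simp: space_restrict_space)
    finally show ?thesis unfolding distr_I_eq_M .
  qed
  then have "distr uniform01 borel J = N"
    using sets by (intro measure_eqI) auto
  moreover have "distr uniform01 N J = distr uniform01 borel J"
    by (rule distr_cong) (auto simp: sets)
  ultimately have "distr uniform01 N J = N"
    by simp
  moreover have "AE \<omega> in uniform01. C (J \<omega>) = \<omega>"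
  proof (rule AE_uniform_measureI, simp, rule AE_I2, intro impI)
    fix \<omega> :: real assume \<omega>: "\<omega> \<in> {0<..<1}"
    have ge: "\<omega> \<le> C (I \<omega>)"
      using pseudoinverse[of \<omega> "I \<omega>"] \<omega> by simp
    \<comment> \<open>By continuity a strict excess would persist at some x < I \<omega>, whereas
      \<omega> \<le> C x forces I \<omega> \<le> x.\<close>
    have "\<not> \<omega> < C (I \<omega>)"
    proof
      assume "\<omega> < C (I \<omega>)"
      moreover have "isCont C (I \<omega>)"
        using isCont_cdf null by simp
      then have "(C \<longlongrightarrow> C (I \<omega>)) (at_left (I \<omega>))"
        unfolding isCont_def by (rule filterlim_at_split[THEN iffD1, THEN conjunct1])
      ultimately have "eventually (\<lambda>x. \<omega> < C x) (at_left (I \<omega>))"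
        by (simp add: order_tendstoD(1))
      moreover have "eventually (\<lambda>x. x < I \<omega>) (at_left (I \<omega>))"
        by (simp add: eventually_at_filter)
      ultimately have "eventually (\<lambda>x. \<omega> < C x \<and> x < I \<omega>) (at_left (I \<omega>))"
        by eventually_elim simp
      then obtain x where "\<omega> < C x" "x < I \<omega>"
        using eventually_happens'[OF trivial_limit_at_left_real] by blast
      then show False using pseudoinverse[of \<omega> x] \<omega> by simp
    qed
    with ge show "C (J \<omega>) = \<omega>"
      using \<omega> by (simp add: J_def)
  qed
  moreover have "measurable uniform01 N = measurable borel borel"
    "measurable N uniform01 = measurable borel borel"
    using sets by (auto intro!: measurable_cong_sets)
  ultimately have "ae_iso uniform01 N J C"
    unfolding ae_iso_def using \<open>J \<in> borel_measurable borel\<close> measurable_C by blast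
  then show thesis by (rule that)
qed

text \<open>The Borel embedding carries M to an atomless law on the line, which the quantile
  transform matches with the uniform law; measurable diagonals allow both maps to be
  reversed.\<close>

lemma ae_iso_standard_uniform01:
  fixes M :: "'a measure"
  assumes std: "standard_borel M" and prob: "prob_space M"
    and null: "\<And>x. x \<in> space M \<Longrightarrow> measure M {x} = 0"
  obtains f g where "ae_iso M uniform01 f g" "ae_iso uniform01 M g f"
proof -
  interpret prob_space M by fact
  obtain \<rho> :: "'a \<Rightarrow> real" and \<kappa> :: "real \<Rightarrow> 'a" where meas[measurable]: "\<rho> \<in> borel_measurable M" "\<kappa> \<in> measurable borel M"
    and \<kappa>: "\<And>x. x \<in> space M \<Longrightarrow> \<kappa> (\<rho> x) = x"
    using standard_borel_embedding[OF std not_empty] by blast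
  define N where "N = distr M borel \<rho>"
  have 1: "ae_iso M N \<rho> \<kappa>"
    unfolding ae_iso_def N_def using \<kappa> by (auto intro!: distr_cong)
  have [measurable]: "{y \<in> space N. \<rho> (\<kappa> y) = y} \<in> sets N"
    unfolding N_def by measurable
  have 2: "ae_iso N M \<kappa> \<rho>"
    by (rule ae_iso_sym[OF 1]) measurable
  have "measure N {y} = 0" for y
  proof -
    have "measure N {y} = measure M (\<rho> -` {y} \<inter> space M)"
      unfolding N_def by (subst measure_distr) auto
    also have "\<dots> \<le> measure M {\<kappa> y}"
    proof (rule finite_measure_mono)
      show "\<rho> -` {y} \<inter> space M \<subseteq> {\<kappa> y}" using \<kappa> by force
      have "{\<kappa> y} = {x \<in> space M. \<rho> x = \<rho> (\<kappa> y)}"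
      proof -
        have y: "\<kappa> y \<in> space M"
          using measurable_space[OF meas(2), of y] by simp
        have "x = \<kappa> y" if "x \<in> space M" "\<rho> x = \<rho> (\<kappa> y)" for x
          using \<kappa>[OF that(1)] \<kappa>[OF y] that(2) by metis
        then show ?thesis
          using y by auto
      qed
      also have "\<dots> \<in> sets M" by measurable
      finally show "{\<kappa> y} \<in> sets M" .
    qed
    also have "measure M {\<kappa> y} = 0"
      using null measurable_space[OF meas(2), of y] by simp
    finally show ?thesis by (simp add: measure_le_0_iff)
  qed
  moreover have "prob_space N"
    unfolding N_def by (rule prob_space_distr) measurable
  ultimately obtain f g where fg: "ae_iso uniform01 N f g"
    using ae_iso_uniform01[of N] unfolding N_def by auto
  have gf: "ae_iso N uniform01 g f"
  proof (rule ae_iso_sym[OF fg])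
    have "measurable uniform01 N = measurable borel borel"
      "measurable N uniform01 = measurable borel borel"
      unfolding N_def by (auto intro!: measurable_cong_sets)
    then have [measurable]: "f \<in> borel_measurable borel" "g \<in> borel_measurable borel"
      using fg unfolding ae_iso_def by blast+
    have "{y. f (g y) = y} \<in> sets borel" by measurable
    then show "{y \<in> space N. f (g y) = y} \<in> sets N"
      unfolding N_def by simp
  qed
  show thesis
  proof
    show "ae_iso M uniform01 (g \<circ> \<rho>) (\<kappa> \<circ> f)"
      by (intro ae_iso_trans[OF 1 gf])
    show "ae_iso uniform01 M (\<kappa> \<circ> f) (g \<circ> \<rho>)"
      by (intro ae_iso_trans[OF fg 2])
  qed
qed

section \<open>Equivariant labellings\<close>

text \<open>Finite sums of the probabilities are at most 1, so they are summable. This tames a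
  family obtained from Zorn's lemma, which may be uncountable.\<close>

lemma (in prob_space) countable_AE_disjoint:
  assumes meas: "\<And>i. i \<in> I \<Longrightarrow> C i \<in> events"
    and disj: "\<And>i j. i \<in> I \<Longrightarrow> j \<in> I \<Longrightarrow> i \<noteq> j \<Longrightarrow> AE x in M. x \<notin> C i \<or> x \<notin> C j"
  shows "countable {i \<in> I. prob (C i) \<noteq> 0}"
proof -
  have "(\<lambda>i. prob (C i)) summable_on I"
  proof (rule nonneg_bdd_above_summable_on)
    have "sum (\<lambda>i. prob (C i)) J \<le> 1" if "J \<subseteq> I" "finite J" for J
    proof -
      have "sum (\<lambda>i. prob (C i)) J = prob (\<Union> (C ` J))"
      proof (rule measure_UNION_AE[symmetric])
        show "C i \<in> fmeasurable M" if "i \<in> J" for i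
          using meas that \<open>J \<subseteq> I\<close> by (auto simp: fmeasurable_eq_sets)
        show "pairwise (\<lambda>i j. AE x in M. x \<notin> C i \<or> x \<notin> C j) J"
          using disj \<open>J \<subseteq> I\<close> unfolding pairwise_def by blast
      qed fact
      then show ?thesis by simp
    qed
    then show "bdd_above (sum (\<lambda>i. prob (C i)) ` {F. F \<subseteq> I \<and> finite F})"
      by (intro bdd_aboveI[of _ 1]) auto
  qed simp
  then have "(\<lambda>i. norm (prob (C i))) summable_on I"
    by simp
  then show ?thesis
    by (rule abs_summable_countable)
qed

text \<open>This is a right action, as precomposition of sequences with permutations is. The action
  laws hold at every point, so null sets come only from the other almost-everywhere
  statements.\<close>

locale pmp_action = prob_space P for P :: "'b measure" +
  fixes \<Gamma> :: "('i \<Rightarrow> 'i) set" and T :: "('i \<Rightarrow> 'i) \<Rightarrow> 'b \<Rightarrow> 'b"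
  assumes countable_\<Gamma>: "countable \<Gamma>"
    and id_in: "id \<in> \<Gamma>"
    and comp_in: "\<sigma> \<in> \<Gamma> \<Longrightarrow> \<tau> \<in> \<Gamma> \<Longrightarrow> \<sigma> \<circ> \<tau> \<in> \<Gamma>"
    and bij_\<Gamma>: "\<sigma> \<in> \<Gamma> \<Longrightarrow> bij \<sigma>"
    and inv_in: "\<sigma> \<in> \<Gamma> \<Longrightarrow> inv_into UNIV \<sigma> \<in> \<Gamma>"
    and T_meas: "\<sigma> \<in> \<Gamma> \<Longrightarrow> T \<sigma> \<in> measurable P P"
    and T_distr: "\<sigma> \<in> \<Gamma> \<Longrightarrow> distr P P (T \<sigma>) = P"
    and T_id: "T id \<omega> = \<omega>"
    and T_comp: "T (\<sigma> \<circ> \<tau>) \<omega> = T \<tau> (T \<sigma> \<omega>)"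
begin

lemma inv_comp:
  assumes "\<sigma> \<in> \<Gamma>"
  shows "\<sigma> \<circ> inv_into UNIV \<sigma> = id" "inv_into UNIV \<sigma> \<circ> \<sigma> = id"
  using bij_\<Gamma>[OF assms] by (auto simp: bij_def surj_iff inj_iff)

lemma T_inv:
  assumes "\<sigma> \<in> \<Gamma>"
  shows "T (inv_into UNIV \<sigma>) (T \<sigma> \<omega>) = \<omega>" "T \<sigma> (T (inv_into UNIV \<sigma>) \<omega>) = \<omega>"
  using inv_comp[OF assms] by (simp_all add: T_id flip: T_comp)

lemma T_quotient:
  assumes "\<sigma> \<in> \<Gamma>"
  shows "T (inv_into UNIV \<sigma> \<circ> \<tau>) (T \<sigma> \<omega>) = T \<tau> \<omega>"
  by (simp only: T_comp[symmetric] o_assoc inv_comp[OF assms] id_comp)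

lemma AE_T:
  assumes "\<sigma> \<in> \<Gamma>" "AE \<omega> in P. Q \<omega>"
  shows "AE \<omega> in P. Q (T \<sigma> \<omega>)"
  using AE_distrD[OF T_meas[OF assms(1)], of Q] assms(2) unfolding T_distr[OF assms(1)] by blast

lemma prob_T:
  assumes "\<sigma> \<in> \<Gamma>" "A \<in> events"
  shows "prob (T \<sigma> -` A \<inter> space P) = prob A"
  using measure_distr[OF T_meas[OF assms(1)], of A] assms(2) unfolding T_distr[OF assms(1)] by simp

text \<open>For a free action these are the functions that are injective along almost every orbit;
  they code the values of maps by reals.\<close>

definition W :: "('b \<Rightarrow> real) set" where
  "W = {w \<in> borel_measurable P. \<forall>\<pi>\<in>\<Gamma>. \<pi> \<noteq> id \<longrightarrow> (AE \<omega> in P. w (T \<pi> \<omega>) \<noteq> w \<omega>)}"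

text \<open>A pair is a partial map, given by a domain and a code of its values. Separation says
  that no \<Gamma>-translate of the graph of \<open>q\<close> meets the graph of \<open>p\<close> in
  positive measure.\<close>

definition sep :: "'b set \<times> ('b \<Rightarrow> real) \<Rightarrow> 'b set \<times> ('b \<Rightarrow> real) \<Rightarrow> bool" where
  "sep p q \<longleftrightarrow> (\<forall>\<sigma>\<in>\<Gamma>. AE \<omega> in P. \<not> (\<omega> \<in> fst p \<and> T \<sigma> \<omega> \<in> fst q \<and> snd p \<omega> = snd q (T \<sigma> \<omega>)))"

lemma sep_sym:
  assumes "sep p q" shows "sep q p"
  unfolding sep_def
proof
  fix \<sigma> assume \<sigma>: "\<sigma> \<in> \<Gamma>"
  have "AE \<omega> in P. \<not> (\<omega> \<in> fst p \<and> T (inv_into UNIV \<sigma>) \<omega> \<in> fst q \<and> snd p \<omega> = snd q (T (inv_into UNIV \<sigma>) \<omega>))"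
    using assms inv_in[OF \<sigma>] unfolding sep_def by blast
  from AE_T[OF \<sigma> this]
  show "AE \<omega> in P. \<not> (\<omega> \<in> fst q \<and> T \<sigma> \<omega> \<in> fst p \<and> snd q \<omega> = snd p (T \<sigma> \<omega>))"
    by eventually_elim (auto simp: T_inv[OF \<sigma>])
qed

section \<open>Maximal separated families and the labels they define\<close>

definition sep_families :: "('b set \<times> ('b \<Rightarrow> real)) set set" where
  "sep_families = {F. F \<subseteq> events \<times> W \<and> pairwise sep F}"

lemma maximal_sep_family: "\<exists>F\<in>sep_families. \<forall>F'\<in>sep_families. F \<subseteq> F' \<longrightarrow> F' = F"
proof (rule subset_Zorn')
  fix \<C> assume chain: "subset.chain sep_families \<C>"
  then have sub: "\<And>F. F \<in> \<C> \<Longrightarrow> F \<subseteq> events \<times> W \<and> pairwise sep F"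
    and tot: "\<And>F F'. F \<in> \<C> \<Longrightarrow> F' \<in> \<C> \<Longrightarrow> F \<subseteq> F' \<or> F' \<subseteq> F"
    unfolding sep_families_def subset_chain_def by blast+
  have "pairwise sep (\<Union>\<C>)"
    using sub tot by (intro pairwise_chain_Union) (auto simp: chain_subset_def)
  then show "\<Union>\<C> \<in> sep_families"
    using sub unfolding sep_families_def by blast
qed

text \<open>The part of the graph of \<open>w\<close> covered by the translate of the partial map
  \<open>p\<close> by \<sigma>, seen in the domain.\<close>

definition agree :: "('b \<Rightarrow> real) \<Rightarrow> ('b set \<times> ('b \<Rightarrow> real)) \<times> ('i \<Rightarrow> 'i) \<Rightarrow> 'b set" where
  "agree w = (\<lambda>(p, \<sigma>). {\<omega> \<in> space P. T \<sigma> \<omega> \<in> fst p \<and> w \<omega> = snd p (T \<sigma> \<omega>)})"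

text \<open>Chosen once, independently of \<open>w\<close>: this is what makes the labels
  equivariant under \<Gamma> and local in \<open>w\<close>.\<close>

definition fam :: "('b set \<times> ('b \<Rightarrow> real)) set" where
  "fam = (SOME F. F \<in> sep_families \<and> (\<forall>F'\<in>sep_families. F \<subseteq> F' \<longrightarrow> F' = F))"

lemma fam: "fam \<in> sep_families" "F' \<in> sep_families \<Longrightarrow> fam \<subseteq> F' \<Longrightarrow> F' = fam"
proof -
  have "\<exists>F. F \<in> sep_families \<and> (\<forall>F'\<in>sep_families. F \<subseteq> F' \<longrightarrow> F' = F)"
    using maximal_sep_family by blast
  from someI_ex[OF this]
  show "fam \<in> sep_families" "F' \<in> sep_families \<Longrightarrow> fam \<subseteq> F' \<Longrightarrow> F' = fam"
    unfolding fam_def by blast+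
qed

lemma fam_sub: "p \<in> fam \<Longrightarrow> fst p \<in> events \<and> snd p \<in> W"
  using fam(1) unfolding sep_families_def by (cases p) auto

lemma agree_events[measurable]:
  assumes "w \<in> borel_measurable P" "p \<in> fam" "\<sigma> \<in> \<Gamma>"
  shows "agree w (p, \<sigma>) \<in> events"
proof -
  have [measurable]: "w \<in> borel_measurable P" "fst p \<in> events" "snd p \<in> borel_measurable P" "T \<sigma> \<in> measurable P P"
    using assms fam_sub T_meas unfolding W_def by auto
  show ?thesis unfolding agree_def prod.case by measurable
qed

text \<open>Seen from T \<sigma> \<omega>, only the relative position of \<tau> with respect to
  \<sigma> matters. Different members of the family are separated; for a single member the relative
  position is not the identity, and a function in \<open>W\<close> takes a different value
  there.\<close>

lemma agree_disjoint:
  assumes "x \<in> fam \<times> \<Gamma>" "y \<in> fam \<times> \<Gamma>" "x \<noteq> y"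
  shows "AE \<omega> in P. \<omega> \<notin> agree w x \<or> \<omega> \<notin> agree w y"
proof -
  obtain p \<sigma> q \<tau> where xy: "x = (p, \<sigma>)" "y = (q, \<tau>)" by (cases x, cases y)
  have in\<Gamma>: "\<sigma> \<in> \<Gamma>" "\<tau> \<in> \<Gamma>" "p \<in> fam" "q \<in> fam" using assms xy by auto
  let ?\<rho> = "inv_into UNIV \<sigma> \<circ> \<tau>"
  have \<rho>: "?\<rho> \<in> \<Gamma>" using in\<Gamma> inv_in comp_in by blast
  have "AE \<omega> in P. \<not> (\<omega> \<in> fst p \<and> T ?\<rho> \<omega> \<in> fst q \<and> snd p \<omega> = snd q (T ?\<rho> \<omega>))"
  proof (cases "p = q")
    case False
    then have "sep p q"
      using fam(1) in\<Gamma> unfolding sep_families_def pairwise_def by blast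
    then show ?thesis using \<rho> unfolding sep_def by blast
  next
    case True
    have "?\<rho> \<noteq> id"
    proof
      assume "?\<rho> = id"
      then have "\<sigma> \<circ> ?\<rho> = \<sigma>" by simp
      then have "\<tau> = \<sigma>" using inv_comp[OF in\<Gamma>(1)] by (simp add: o_assoc)
      then show False using True assms(3) xy by simp
    qed
    then have "AE \<omega> in P. snd p (T ?\<rho> \<omega>) \<noteq> snd p \<omega>"
      using fam_sub[OF in\<Gamma>(3)] \<rho> unfolding W_def by blast
    then show ?thesis using True by (auto elim!: AE_mp)
  qed
  from AE_T[OF in\<Gamma>(1) this] show ?thesis
    by eventually_elim (auto simp: agree_def xy T_quotient[OF in\<Gamma>(1)])
qed

text \<open>Since the family may be uncountable, unions are restricted to the pairs that occur with
  positive probability; every other pair is discarded at the cost of its own null set.\<close>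

definition supp :: "('b \<Rightarrow> real) \<Rightarrow> (('b set \<times> ('b \<Rightarrow> real)) \<times> ('i \<Rightarrow> 'i)) set" where
  "supp w = {x \<in> fam \<times> \<Gamma>. prob (agree w x) \<noteq> 0}"

lemma countable_supp: "w \<in> borel_measurable P \<Longrightarrow> countable (supp w)"
  unfolding supp_def using agree_events by (intro countable_AE_disjoint agree_disjoint) auto

lemma AE_supp:
  assumes "w \<in> borel_measurable P" "x \<in> fam \<times> \<Gamma>" "x \<notin> supp w"
  shows "AE \<omega> in P. \<omega> \<notin> agree w x"
proof (rule AE_not_in)
  have "agree w x \<in> events" using assms agree_events by auto
  then show "agree w x \<in> null_sets P"
    using assms unfolding supp_def by (auto simp: emeasure_eq_measure intro!: null_setsI)
qed

text \<open>Off a null set, \<open>\<omega>\<close> lies in \<open>agree w (p, \<sigma>)\<close> for exactly one pair, and \<open>reach i w A\<close>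
  is the set where the corresponding \<open>\<sigma>\<close> sends \<open>i\<close> into \<open>A\<close>.\<close>

definition reach :: "'i \<Rightarrow> ('b \<Rightarrow> real) \<Rightarrow> 'i set \<Rightarrow> 'b set" where
  "reach i w A = (\<Union>x\<in>{x \<in> supp w. snd x i \<in> A}. agree w x)"

lemma reach_events:
  assumes "w \<in> borel_measurable P"
  shows "reach i w A \<in> events"
  unfolding reach_def
proof (rule sets.countable_UN'')
  show "countable {x \<in> supp w. snd x i \<in> A}"
    using countable_supp[OF assms] by (rule countable_subset[rotated]) auto
qed (use agree_events assms in \<open>auto simp: supp_def\<close>)

text \<open>This is maximality. If the uncovered set N had positive measure, then
  \<open>(N, w)\<close> would be separated from every member and hence already belong to the family;
  but with the label \<open>id\<close> it covers N.\<close>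

lemma prob_reach_UNIV:
  assumes w: "w \<in> W"
  shows "prob (reach i w UNIV) = 1"
proof (rule ccontr)
  assume ne: "prob (reach i w UNIV) \<noteq> 1"
  have wm: "w \<in> borel_measurable P" using w unfolding W_def by simp
  define N where "N = space P - reach i w UNIV"
  have N: "N \<in> events" unfolding N_def using reach_events[OF wm] by auto
  have "prob N \<noteq> 0"
    using ne prob_compl[OF reach_events[OF wm, of i UNIV]] unfolding N_def by simp
  have sepN: "sep (N, w) p" if p: "p \<in> fam" for p
    unfolding sep_def
  proof
    fix \<sigma> assume \<sigma>: "\<sigma> \<in> \<Gamma>"
    have "AE \<omega> in P. \<not> (\<omega> \<in> N \<and> \<omega> \<in> agree w (p, \<sigma>))"
    proof (cases "(p, \<sigma>) \<in> supp w")
      case True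
      then show ?thesis unfolding N_def reach_def by auto
    next
      case False
      then show ?thesis using AE_supp[OF wm, of "(p, \<sigma>)"] p \<sigma> by (auto elim!: AE_mp)
    qed
    then show "AE \<omega> in P. \<not> (\<omega> \<in> fst (N, w) \<and> T \<sigma> \<omega> \<in> fst p \<and> snd (N, w) \<omega> = snd p (T \<sigma> \<omega>))"
      by eventually_elim (auto simp: agree_def N_def)
  qed
  have "insert (N, w) fam \<in> sep_families"
    using fam(1) sepN sep_sym N w unfolding sep_families_def
    by (auto simp: pairwise_insert)
  then have inF: "(N, w) \<in> fam"
    using fam(2) by blast
  have "agree w ((N, w), id) = N"
    unfolding agree_def using sets.sets_into_space[OF N] by (auto simp: T_id)
  then have "((N, w), id) \<in> supp w"
    unfolding supp_def using inF id_in \<open>prob N \<noteq> 0\<close> by auto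
  then have "N \<subseteq> reach i w UNIV"
    unfolding reach_def using \<open>agree w ((N, w), id) = N\<close> by force
  then have "N = {}" unfolding N_def by blast
  with \<open>prob N \<noteq> 0\<close> show False by simp
qed

text \<open>Countability of \<open>supp w\<close> merges the pairwise null sets into one, off which
  the label is unique, and a single label cannot send i into both A and B.\<close>

lemma prob_reach_Un:
  assumes w: "w \<in> borel_measurable P" and AB: "A \<inter> B = {}"
  shows "prob (reach i w (A \<union> B)) = prob (reach i w A) + prob (reach i w B)"
proof -
  have "AE \<omega> in P. \<forall>x\<in>supp w. \<forall>y\<in>supp w. x \<noteq> y \<longrightarrow> \<omega> \<notin> agree w x \<or> \<omega> \<notin> agree w y"
    unfolding AE_ball_countable[OF countable_supp[OF w]]
    using agree_disjoint by (auto simp: supp_def)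
  then have "AE \<omega> in P. \<omega> \<notin> reach i w A \<or> \<omega> \<notin> reach i w B"
    by eventually_elim (use AB in \<open>fastforce simp: reach_def\<close>)
  moreover have "reach i w (A \<union> B) = reach i w A \<union> reach i w B"
    unfolding reach_def by auto
  ultimately show ?thesis
    using reach_events[OF w] by (simp add: measure_Un_AE fmeasurable_eq_sets)
qed

text \<open>The pair (p, \<tau>) of \<open>w\<close> at T \<pi> \<omega> is the pair (p, \<pi>
  \<circ> \<tau>) of the shifted function at \<omega>. So the label is composed with \<pi> on the
  left, and T \<pi> preserves the probability.\<close>

lemma prob_reach_shift:
  assumes w: "w \<in> borel_measurable P" and \<pi>: "\<pi> \<in> \<Gamma>"
  shows "prob (reach i (\<lambda>\<omega>. w (T \<pi> \<omega>)) A) = prob (reach i w (\<pi> -` A))"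
proof -
  let ?w = "\<lambda>\<omega>. w (T \<pi> \<omega>)" and ?s = "\<lambda>(p, \<tau>). (p, \<pi> \<circ> \<tau>)"
  have agree: "agree ?w (p, \<pi> \<circ> \<tau>) = T \<pi> -` agree w (p, \<tau>) \<inter> space P" for p \<tau>
    unfolding agree_def using measurable_space[OF T_meas[OF \<pi>]] by (auto simp: T_comp)
  have supp1: "?s x \<in> supp ?w \<longleftrightarrow> x \<in> supp w" if "x \<in> fam \<times> \<Gamma>" for x
    using that comp_in[OF \<pi>] agree prob_T[OF \<pi>] agree_events[OF w] by (auto simp: supp_def)
  have img: "\<exists>x\<in>fam \<times> \<Gamma>. y = ?s x" if "y \<in> fam \<times> \<Gamma>" for y
  proof -
    obtain p \<sigma> where y: "y = (p, \<sigma>)" by (cases y)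
    show ?thesis
    proof
      show "y = ?s (p, inv_into UNIV \<pi> \<circ> \<sigma>)"
        using inv_comp[OF \<pi>] y by (simp add: o_assoc)
      show "(p, inv_into UNIV \<pi> \<circ> \<sigma>) \<in> fam \<times> \<Gamma>"
        using that y comp_in[OF inv_in[OF \<pi>]] by auto
    qed
  qed
  have "supp ?w = ?s ` supp w"
  proof (intro equalityI subsetI)
    fix y assume y: "y \<in> supp ?w"
    then have "y \<in> fam \<times> \<Gamma>" unfolding supp_def by blast
    then obtain x where x: "x \<in> fam \<times> \<Gamma>" "y = ?s x" using img by blast
    then have "x \<in> supp w" using y supp1 by blast
    with x(2) show "y \<in> ?s ` supp w" by blast
  next
    fix y assume "y \<in> ?s ` supp w"
    then obtain x where x: "x \<in> supp w" "y = ?s x" by blast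
    then have "x \<in> fam \<times> \<Gamma>" unfolding supp_def by blast
    then show "y \<in> supp ?w" using x supp1 by blast
  qed
  then have "reach i ?w A = T \<pi> -` reach i w (\<pi> -` A) \<inter> space P"
    unfolding reach_def using agree by fastforce
  then show ?thesis
    using prob_T[OF \<pi> reach_events[OF w]] by simp
qed

text \<open>Membership of \<omega> in \<open>agree w x\<close> involves \<open>w\<close> only
  through its value at \<omega>. The supports of \<open>w\<close> and \<open>v\<close> can differ,
  but this affects only countably many null sets.\<close>

lemma prob_reach_local:
  assumes w: "w \<in> borel_measurable P" and v: "v \<in> borel_measurable P"
  shows "prob (reach i w A) \<le> prob (reach i v A) + prob {\<omega> \<in> space P. w \<omega> \<noteq> v \<omega>}"
proof -
  let ?E = "{\<omega> \<in> space P. w \<omega> \<noteq> v \<omega>}"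
  have E: "?E \<in> events" using w v by measurable
  have agree: "\<omega> \<in> ?E \<or> \<omega> \<in> agree v x" if "\<omega> \<in> agree w x" for \<omega> x
    using that by (auto simp: agree_def)
  have "AE \<omega> in P. \<forall>x\<in>supp w. snd x i \<in> A \<longrightarrow> \<omega> \<in> agree w x \<longrightarrow> \<omega> \<in> reach i v A \<union> ?E"
    unfolding AE_ball_countable[OF countable_supp[OF w]]
  proof
    fix x assume x: "x \<in> supp w"
    show "AE \<omega> in P. snd x i \<in> A \<longrightarrow> \<omega> \<in> agree w x \<longrightarrow> \<omega> \<in> reach i v A \<union> ?E"
    proof (cases "x \<in> supp v")
      case True
      then have "\<omega> \<in> reach i v A" if "snd x i \<in> A" "\<omega> \<in> agree v x" for \<omega>
        using that unfolding reach_def by blast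
      then show ?thesis
        using agree by (intro AE_I2) blast
    next
      case False
      then have "AE \<omega> in P. \<omega> \<notin> agree v x"
        using AE_supp[OF v] x by (auto simp: supp_def)
      then show ?thesis
        by eventually_elim (use agree in blast)
    qed
  qed
  then have "AE \<omega> in P. \<omega> \<in> reach i w A \<longrightarrow> \<omega> \<in> reach i v A \<union> ?E"
    by eventually_elim (auto simp: reach_def)
  then have "prob (reach i w A) \<le> prob (reach i v A \<union> ?E)"
    using reach_events[OF v] E by (intro finite_measure_mono_AE) auto
  also have "\<dots> \<le> prob (reach i v A) + prob ?E"
    using reach_events[OF v] E by (intro measure_Un_le)
  finally show ?thesis .
qed

end

section \<open>Invariant means of amenable topological groups\<close>

text \<open>Bounded functions whose left translates depend continuously on the group element in the
  sup norm; in a topological group this is right uniform continuity. Stating it at each g allows a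
  modulus that depends on g.\<close>

definition left_unif_cont :: "'g monoid \<Rightarrow> 'g topology \<Rightarrow> ('g \<Rightarrow> real) set" where
  "left_unif_cont G T = {f. (\<exists>B. \<forall>x\<in>carrier G. \<bar>f x\<bar> \<le> B) \<and>
     (\<forall>g\<in>carrier G. \<forall>\<epsilon>>0. \<exists>U. openin T U \<and> g \<in> U \<and>
        (\<forall>h\<in>U. \<forall>x\<in>carrier G. \<bar>f (h \<otimes>\<^bsub>G\<^esub> x) - f (g \<otimes>\<^bsub>G\<^esub> x)\<bar> \<le> \<epsilon>))}"

text \<open>The value 0 outside the function space pins each mean down as a point of a product of
  compact intervals. Positivity is tested on the carrier, so values of functions elsewhere do not
  influence a mean.\<close>

definition means :: "'g monoid \<Rightarrow> 'g topology \<Rightarrow> (('g \<Rightarrow> real) \<Rightarrow> real) set" where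
  "means G T = {m.
     (\<forall>f\<in>left_unif_cont G T. \<forall>f'\<in>left_unif_cont G T. m (\<lambda>x. f x + f' x) = m f + m f') \<and>
     (\<forall>f\<in>left_unif_cont G T. \<forall>c. m (\<lambda>x. c * f x) = c * m f) \<and>
     (\<forall>f\<in>left_unif_cont G T. (\<forall>x\<in>carrier G. 0 \<le> f x) \<longrightarrow> 0 \<le> m f) \<and>
     m (\<lambda>_. 1) = 1 \<and> (\<forall>f. f \<notin> left_unif_cont G T \<longrightarrow> m f = 0)}"

definition fun_module :: "(real, 'b \<Rightarrow> real) module" where
  "fun_module = \<lparr>carrier = UNIV, mult = (\<lambda>x y. x), one = (\<lambda>_. 0), ring.zero = (\<lambda>_. 0),
     add = (\<lambda>x y i. x i + y i), smult = (\<lambda>a x i. a * x i)\<rparr>"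

lemma module_fun_module: "module real_ring fun_module"
proof (rule moduleI)
  have "abelian_group real_ring"
    by (rule abelian_groupI) (auto simp: real_ring_def intro: exI[of _ "- x" for x])
  moreover have "comm_monoid real_ring"
    by (rule comm_monoidI) (auto simp: real_ring_def)
  ultimately show "cring real_ring"
    by (rule cringI) (auto simp: real_ring_def algebra_simps)
  show "abelian_group fun_module"
  proof (rule abelian_groupI)
    fix x :: "'b \<Rightarrow> real"
    show "\<exists>y\<in>carrier fun_module. y \<oplus>\<^bsub>fun_module\<^esub> x = \<zero>\<^bsub>fun_module\<^esub>"
      by (intro bexI[of _ "\<lambda>i. - x i"]) (auto simp: fun_module_def)
  qed (auto simp: fun_module_def algebra_simps)
qed (auto simp: fun_module_def real_ring_def algebra_simps)

lemma locally_convex_fun_module: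
  "locally_convex_Hausdorff_tvs (fun_module :: (real, 'b \<Rightarrow> real) module) euclidean"
  unfolding locally_convex_Hausdorff_tvs_def
proof (intro conjI allI impI)
  let ?V = "fun_module :: (real, 'b \<Rightarrow> real) module"
  show "module real_ring ?V"
    by (rule module_fun_module)
  show "topspace euclidean = carrier ?V"
    by (simp add: fun_module_def)
  have "continuous_on UNIV (\<lambda>z :: ('b \<Rightarrow> real) \<times> ('b \<Rightarrow> real). \<lambda>i. fst z i + snd z i)"
    by (intro continuous_on_coordinatewise_then_product continuous_on_add;
        rule continuous_on_product_then_coordinatewise; intro continuous_intros)
  then show "continuous_map (prod_topology euclidean euclidean) euclidean (\<lambda>(x, y). x \<oplus>\<^bsub>?V\<^esub> y)"
    by (simp add: fun_module_def case_prod_unfold)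
  have "continuous_on UNIV (\<lambda>z :: real \<times> ('b \<Rightarrow> real). \<lambda>i. fst z * snd z i)"
    by (intro continuous_on_coordinatewise_then_product continuous_on_mult continuous_on_fst
          continuous_on_id; rule continuous_on_product_then_coordinatewise; intro continuous_intros)
  then show "continuous_map (prod_topology euclideanreal euclidean) euclidean (\<lambda>(a, x). a \<odot>\<^bsub>?V\<^esub> x)"
    by (simp add: fun_module_def case_prod_unfold)
  show "Hausdorff_space (euclidean :: ('b \<Rightarrow> real) topology)"
    unfolding euclidean_product_topology[symmetric]
    by (simp add: Hausdorff_space_product_topology)
  fix U assume "openin euclidean U \<and> \<zero>\<^bsub>?V\<^esub> \<in> U"
  then have U: "openin (product_topology (\<lambda>_. euclideanreal) UNIV) U" "(\<lambda>_. 0) \<in> U"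
    by (auto simp: euclidean_product_topology fun_module_def)
  then obtain X where X: "finite {i. X i \<noteq> (UNIV :: real set)}" "\<And>i. open (X i)"
    "(\<lambda>_. 0) \<in> Pi\<^sub>E UNIV X" "Pi\<^sub>E UNIV X \<subseteq> U"
    unfolding openin_product_topology_alt by (auto simp del: PiE_UNIV_domain)
  have "\<exists>e>0. ball 0 e \<subseteq> X i" for i
    using X(2,3) open_contains_ball[of "X i"] by auto
  then obtain e where e: "\<And>i. e i > 0" "\<And>i. ball 0 (e i) \<subseteq> X i"
    by metis
  \<comment> \<open>Unrestricted coordinates stay unrestricted, so that the smaller convex box still
    constrains finitely many coordinates and is open.\<close>
  define Y :: "'b \<Rightarrow> real set" where "Y i = (if X i = UNIV then UNIV else ball 0 (e i))" for i
  have Y: "convex (Y i)" "open (Y i)" "0 \<in> Y i" "Y i \<subseteq> X i" for i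
    using e[of i] by (auto simp: Y_def)
  show "\<exists>W. openin euclidean W \<and> \<zero>\<^bsub>?V\<^esub> \<in> W \<and> W \<subseteq> U \<and> convex_in ?V W"
  proof (intro exI conjI)
    have "{i. Y i \<noteq> UNIV} \<subseteq> {i. X i \<noteq> UNIV}"
      by (auto simp: Y_def)
    then show "openin euclidean (Pi\<^sub>E UNIV Y)"
      using open_PiE[of Y] Y(2) X(1) by (simp add: finite_subset)
    show "\<zero>\<^bsub>?V\<^esub> \<in> Pi\<^sub>E UNIV Y"
      using Y(3) by (simp add: fun_module_def PiE_UNIV_domain)
    show "Pi\<^sub>E UNIV Y \<subseteq> U"
      using X(4) Y(4) by (meson PiE_mono order_trans)
    have "(1 - t) * u + t * v \<in> Y i" if "u \<in> Y i" "v \<in> Y i" "0 \<le> t" "t \<le> 1" for u v t i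
      using convexD[OF Y(1) that(1,2), of "1 - t" t] that by simp
    then show "convex_in ?V (Pi\<^sub>E UNIV Y)"
      unfolding convex_in_def fun_module_def PiE_UNIV_domain by (simp add: Pi_iff)
  qed
qed

text \<open>Continuity of left translations pulls a neighbourhood of a \<otimes> g back to one of g,
  which is how \<open>translate_in_E\<close> works.\<close>

locale semitop_group = group G for G :: "'a monoid" (structure) +
  fixes T :: "'a topology"
  assumes topspace: "topspace T = carrier G"
    and left_cont: "\<And>h. h \<in> carrier G \<Longrightarrow> continuous_map T T (\<lambda>g. h \<otimes> g)"
begin

abbreviation "E \<equiv> left_unif_cont G T"

section \<open>Closure properties of the space of uniformly continuous functions\<close>

lemma const_in_E: "(\<lambda>_. c) \<in> E"
proof -
  have "\<exists>U. openin T U \<and> g \<in> U" if "g \<in> carrier G" for g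
    using that openin_topspace[of T] topspace by metis
  then show ?thesis unfolding left_unif_cont_def by fastforce
qed

lemma add_in_E:
  assumes "f \<in> E" "f' \<in> E"
  shows "(\<lambda>x. f x + f' x) \<in> E"
  unfolding left_unif_cont_def
proof (intro CollectI conjI ballI allI impI)
  obtain B B' where "\<forall>x\<in>carrier G. \<bar>f x\<bar> \<le> B" "\<forall>x\<in>carrier G. \<bar>f' x\<bar> \<le> B'"
    using assms unfolding left_unif_cont_def by blast
  then have "\<forall>x\<in>carrier G. \<bar>f x + f' x\<bar> \<le> B + B'" by fastforce
  then show "\<exists>B. \<forall>x\<in>carrier G. \<bar>f x + f' x\<bar> \<le> B" by blast
  fix g \<epsilon> assume g: "g \<in> carrier G" and "(\<epsilon>::real) > 0"
  then have "\<epsilon>/2 > 0" by simp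
  then obtain U U' where U: "openin T U" "g \<in> U" "\<forall>h\<in>U. \<forall>x\<in>carrier G. \<bar>f (h \<otimes> x) - f (g \<otimes> x)\<bar> \<le> \<epsilon>/2"
    and U': "openin T U'" "g \<in> U'" "\<forall>h\<in>U'. \<forall>x\<in>carrier G. \<bar>f' (h \<otimes> x) - f' (g \<otimes> x)\<bar> \<le> \<epsilon>/2"
    using assms g unfolding left_unif_cont_def by blast
  show "\<exists>U. openin T U \<and> g \<in> U \<and> (\<forall>h\<in>U. \<forall>x\<in>carrier G. \<bar>f (h \<otimes> x) + f' (h \<otimes> x) - (f (g \<otimes> x) + f' (g \<otimes> x))\<bar> \<le> \<epsilon>)"
  proof (intro exI conjI ballI)
    show "openin T (U \<inter> U')" "g \<in> U \<inter> U'" using U U' by auto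
    fix h x assume "h \<in> U \<inter> U'" "x \<in> carrier G"
    then have "\<bar>f (h \<otimes> x) - f (g \<otimes> x)\<bar> \<le> \<epsilon>/2" "\<bar>f' (h \<otimes> x) - f' (g \<otimes> x)\<bar> \<le> \<epsilon>/2"
      using U U' by auto
    then show "\<bar>f (h \<otimes> x) + f' (h \<otimes> x) - (f (g \<otimes> x) + f' (g \<otimes> x))\<bar> \<le> \<epsilon>" by linarith
  qed
qed

lemma scale_in_E:
  assumes "f \<in> E"
  shows "(\<lambda>x. c * f x) \<in> E"
  unfolding left_unif_cont_def
proof (intro CollectI conjI ballI allI impI)
  obtain B where "\<forall>x\<in>carrier G. \<bar>f x\<bar> \<le> B"
    using assms unfolding left_unif_cont_def by blast
  then have "\<forall>x\<in>carrier G. \<bar>c * f x\<bar> \<le> \<bar>c\<bar> * B" by (simp add: abs_mult mult_left_mono)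
  then show "\<exists>B. \<forall>x\<in>carrier G. \<bar>c * f x\<bar> \<le> B" by blast
  fix g \<epsilon> assume g: "g \<in> carrier G" and \<epsilon>: "(\<epsilon>::real) > 0"
  \<comment> \<open>The added 1 covers the case c = 0.\<close>
  then have "\<epsilon> / (\<bar>c\<bar> + 1) > 0" by simp
  then obtain U where U: "openin T U" "g \<in> U" "\<forall>h\<in>U. \<forall>x\<in>carrier G. \<bar>f (h \<otimes> x) - f (g \<otimes> x)\<bar> \<le> \<epsilon> / (\<bar>c\<bar> + 1)"
    using assms g unfolding left_unif_cont_def by blast
  have "\<bar>c * f (h \<otimes> x) - c * f (g \<otimes> x)\<bar> \<le> \<epsilon>" if "h \<in> U" "x \<in> carrier G" for h x
  proof -
    have "\<bar>c * f (h \<otimes> x) - c * f (g \<otimes> x)\<bar> = \<bar>c\<bar> * \<bar>f (h \<otimes> x) - f (g \<otimes> x)\<bar>"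
      by (simp flip: abs_mult right_diff_distrib)
    also have "\<dots> \<le> (\<bar>c\<bar> + 1) * (\<epsilon> / (\<bar>c\<bar> + 1))"
      using U that by (intro mult_mono) auto
    finally show ?thesis by simp
  qed
  with U show "\<exists>U. openin T U \<and> g \<in> U \<and> (\<forall>h\<in>U. \<forall>x\<in>carrier G. \<bar>c * f (h \<otimes> x) - c * f (g \<otimes> x)\<bar> \<le> \<epsilon>)"
    by blast
qed

lemma translate_in_E:
  assumes f: "f \<in> E" and a: "a \<in> carrier G"
  shows "(\<lambda>x. f (a \<otimes> x)) \<in> E"
  unfolding left_unif_cont_def
proof (intro CollectI conjI ballI allI impI)
  show "\<exists>B. \<forall>x\<in>carrier G. \<bar>f (a \<otimes> x)\<bar> \<le> B"
    using f m_closed[OF a] unfolding left_unif_cont_def by blast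
  fix g \<epsilon> assume g: "g \<in> carrier G" and \<epsilon>: "(\<epsilon>::real) > 0"
  then obtain U where U: "openin T U" "a \<otimes> g \<in> U"
      "\<forall>h\<in>U. \<forall>x\<in>carrier G. \<bar>f (h \<otimes> x) - f ((a \<otimes> g) \<otimes> x)\<bar> \<le> \<epsilon>"
    using f a g m_closed[OF a g] unfolding left_unif_cont_def by blast
  define U' where "U' = {h \<in> carrier G. a \<otimes> h \<in> U}"
  have "openin T U'"
    unfolding U'_def using openin_continuous_map_preimage[OF left_cont[OF a] U(1)] topspace by simp
  moreover have "g \<in> U'" using U g unfolding U'_def by simp
  moreover have "\<bar>f (a \<otimes> (h \<otimes> x)) - f (a \<otimes> (g \<otimes> x))\<bar> \<le> \<epsilon>" if "h \<in> U'" "x \<in> carrier G" for h x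
    using U(3) that a g unfolding U'_def by (auto simp: m_assoc)
  ultimately show "\<exists>U. openin T U \<and> g \<in> U \<and> (\<forall>h\<in>U. \<forall>x\<in>carrier G. \<bar>f (a \<otimes> (h \<otimes> x)) - f (a \<otimes> (g \<otimes> x))\<bar> \<le> \<epsilon>)"
    by blast
qed

section \<open>Elementary properties of means\<close>

lemma means_add: "m \<in> means G T \<Longrightarrow> f \<in> E \<Longrightarrow> f' \<in> E \<Longrightarrow> m (\<lambda>x. f x + f' x) = m f + m f'"
  and means_scale: "m \<in> means G T \<Longrightarrow> f \<in> E \<Longrightarrow> m (\<lambda>x. c * f x) = c * m f"
  and means_nonneg: "m \<in> means G T \<Longrightarrow> f \<in> E \<Longrightarrow> (\<And>x. x \<in> carrier G \<Longrightarrow> 0 \<le> f x) \<Longrightarrow> 0 \<le> m f"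
  and means_one: "m \<in> means G T \<Longrightarrow> m (\<lambda>_. 1) = 1"
  and means_zero: "m \<in> means G T \<Longrightarrow> f \<notin> E \<Longrightarrow> m f = 0"
  unfolding means_def by blast+

lemma means_const: "m \<in> means G T \<Longrightarrow> m (\<lambda>_. c) = c"
  using means_scale[OF _ const_in_E, of m c 1] means_one[of m] by simp

lemma means_mono:
  assumes m: "m \<in> means G T" and f: "f \<in> E" "f' \<in> E" and le: "\<And>x. x \<in> carrier G \<Longrightarrow> f x \<le> f' x"
  shows "m f \<le> m f'"
proof -
  have "0 \<le> m (\<lambda>x. f' x + (-1) * f x)"
    using le f by (intro means_nonneg[OF m] add_in_E scale_in_E) auto
  also have "\<dots> = m f' + m (\<lambda>x. (-1) * f x)"
    using f by (intro means_add[OF m] scale_in_E)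
  also have "m (\<lambda>x. (-1) * f x) = (-1) * m f"
    using f by (intro means_scale[OF m])
  finally show ?thesis by simp
qed

text \<open>Compare f with f' + \<epsilon> in both directions. With \<epsilon> = 0 the bound
  identifies the means of functions that agree on the carrier.\<close>

lemma means_dist:
  assumes m: "m \<in> means G T" and f: "f \<in> E" "f' \<in> E"
    and le: "\<And>x. x \<in> carrier G \<Longrightarrow> \<bar>f x - f' x\<bar> \<le> \<epsilon>"
  shows "\<bar>m f - m f'\<bar> \<le> \<epsilon>"
proof -
  have 1: "m h \<le> m h' + \<epsilon>" if "h \<in> E" "h' \<in> E" "\<And>x. x \<in> carrier G \<Longrightarrow> h x \<le> h' x + \<epsilon>" for h h'
    using means_mono[OF m that(1) add_in_E[OF that(2) const_in_E[of \<epsilon>]]] that(3)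
      means_add[OF m that(2) const_in_E[of \<epsilon>]] means_const[OF m] by simp
  have "f x \<le> f' x + \<epsilon>" "f' x \<le> f x + \<epsilon>" if "x \<in> carrier G" for x
    using le[OF that] by linarith+
  then show ?thesis using 1[of f f'] 1[of f' f] f by fastforce
qed

text \<open>Precomposing functions reverses the order of products and dualising reverses it again,
  so this is a left action. The outer restriction makes each map extensional, as \<open>Bij\<close>
  demands.\<close>

definition act :: "'a \<Rightarrow> (('a \<Rightarrow> real) \<Rightarrow> real) \<Rightarrow> ('a \<Rightarrow> real) \<Rightarrow> real" where
  "act g = (\<lambda>m\<in>means G T. \<lambda>f. if f \<in> E then m (\<lambda>x. f (g \<otimes> x)) else 0)"

lemma act_in:
  assumes g: "g \<in> carrier G" and m: "m \<in> means G T"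
  shows "act g m \<in> means G T"
  unfolding means_def
proof (intro CollectI conjI ballI allI impI)
  show "act g m (\<lambda>x. f x + f' x) = act g m f + act g m f'" if "f \<in> E" "f' \<in> E" for f f'
    using that means_add[OF m translate_in_E[OF _ g] translate_in_E[OF _ g]] add_in_E m
    by (simp add: act_def)
  show "act g m (\<lambda>x. c * f x) = c * act g m f" if "f \<in> E" for f c
    using that means_scale[OF m translate_in_E[OF _ g]] scale_in_E m
    by (simp add: act_def)
  show "0 \<le> act g m f" if "f \<in> E" "\<forall>x\<in>carrier G. 0 \<le> f x" for f
    using that means_nonneg[OF m translate_in_E[OF _ g]] m g
    by (simp add: act_def)
  show "act g m (\<lambda>_. 1) = 1"
    using means_one[OF m] const_in_E m by (simp add: act_def)
  show "act g m f = 0" if "f \<notin> E" for f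
    using that m by (simp add: act_def)
qed

lemma act_mult:
  assumes "g \<in> carrier G" "h \<in> carrier G" "m \<in> means G T"
  shows "act (g \<otimes> h) m = act g (act h m)"
proof
  fix f
  have "m (\<lambda>x. f (g \<otimes> h \<otimes> x)) = m (\<lambda>x. f (g \<otimes> (h \<otimes> x)))" if "f \<in> E"
  proof -
    \<comment> \<open>Associativity is available on the carrier only, so the two functions may
      differ elsewhere; the bound 0 still equates their means.\<close>
    have "\<bar>m (\<lambda>x. f (g \<otimes> h \<otimes> x)) - m (\<lambda>x. f (g \<otimes> (h \<otimes> x)))\<bar> \<le> 0"
    proof (rule means_dist[OF assms(3)])
      show "(\<lambda>x. f (g \<otimes> h \<otimes> x)) \<in> E"
        using translate_in_E[OF that m_closed[OF assms(1,2)]] .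
      show "(\<lambda>x. f (g \<otimes> (h \<otimes> x))) \<in> E"
        using translate_in_E[OF translate_in_E[OF that assms(1)] assms(2)] .
    qed (use assms in \<open>simp add: m_assoc\<close>)
    then show ?thesis by simp
  qed
  then show "act (g \<otimes> h) m f = act g (act h m) f"
    using assms act_in[OF assms(2,3)] translate_in_E[OF _ assms(1)] by (simp add: act_def)
qed

lemma act_one:
  assumes m: "m \<in> means G T"
  shows "act \<one> m = m"
proof
  fix f
  have "m (\<lambda>x. f (\<one> \<otimes> x)) = m f" if "f \<in> E"
  proof -
    have "\<bar>m (\<lambda>x. f (\<one> \<otimes> x)) - m f\<bar> \<le> 0"
      using that translate_in_E[OF that, of "\<one>"] by (intro means_dist[OF m]) auto
    then show ?thesis by simp
  qed
  then show "act \<one> m f = m f"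
    using m means_zero[OF m] by (simp add: act_def)
qed

lemma group_action_act: "group_action G (means G T) act"
proof -
  have bij: "act g \<in> Bij (means G T)" if g: "g \<in> carrier G" for g
  proof -
    have "bij_betw (act g) (means G T) (means G T)"
      using g act_in act_mult[symmetric] act_one
      by (intro bij_betw_byWitness[where f' = "act (inv g)"]) auto
    then show ?thesis unfolding Bij_def by (simp add: act_def)
  qed
  have "act (g \<otimes> h) = compose (means G T) (act g) (act h)"
    if "g \<in> carrier G" "h \<in> carrier G" for g h
  proof
    fix m show "act (g \<otimes> h) m = compose (means G T) (act g) (act h) m"
      using that act_mult by (cases "m \<in> means G T") (auto simp: compose_def act_def)
  qed
  then have "act \<in> hom G (BijGroup (means G T))"
    using bij by (auto simp: hom_def BijGroup_def)
  then show ?thesis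
    unfolding group_action_def group_hom_def group_hom_axioms_def
    using group_BijGroup is_group by auto
qed

text \<open>Banach-Alaoglu by hand: the conditions on a mean are closed in the product topology, and
  bounds on the functions confine the means to a product of compact intervals.\<close>

lemma compact_means: "compact (means G T)"
proof -
  have "\<exists>b. 0 \<le> b \<and> (f \<in> E \<longrightarrow> (\<forall>x\<in>carrier G. \<bar>f x\<bar> \<le> b)) \<and> (f \<notin> E \<longrightarrow> b = 0)" for f
  proof (cases "f \<in> E")
    case True
    then obtain B where "\<forall>x\<in>carrier G. \<bar>f x\<bar> \<le> B" unfolding left_unif_cont_def by blast
    then show ?thesis using True by (intro exI[of _ "max B 0"]) auto
  qed auto
  then obtain b where b: "\<And>f. 0 \<le> b f" "\<And>f x. f \<in> E \<Longrightarrow> x \<in> carrier G \<Longrightarrow> \<bar>f x\<bar> \<le> b f" "\<And>f. f \<notin> E \<Longrightarrow> b f = 0"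
    by metis
  let ?Q = "Pi\<^sub>E UNIV (\<lambda>f. {- b f..b f})"
  have "compactin (product_topology (\<lambda>_. euclideanreal) UNIV) ?Q"
    unfolding compactin_PiE by auto
  then have Q: "compact ?Q"
    by (simp add: euclidean_product_topology)
  have sub: "means G T \<subseteq> ?Q"
  proof
    fix m assume m: "m \<in> means G T"
    have "\<bar>m f\<bar> \<le> b f" for f
    proof (cases "f \<in> E")
      case True
      then have "\<bar>m f - m (\<lambda>_. 0)\<bar> \<le> b f"
        using b(2) const_in_E by (intro means_dist[OF m]) auto
      then show ?thesis using means_const[OF m] by simp
    qed (use means_zero[OF m] b in auto)
    then have "m f \<in> {- b f..b f}" for f
      by (simp add: abs_le_iff minus_le_iff)
    then show "m \<in> ?Q" by auto
  qed
  have "closed (means G T)"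
  proof -
    have "means G T = (\<Inter>f\<in>E. \<Inter>f'\<in>E. {m. m (\<lambda>x. f x + f' x) = m f + m f'}) \<inter>
      (\<Inter>f\<in>E. \<Inter>c. {m. m (\<lambda>x. c * f x) = c * m f}) \<inter>
      (\<Inter>f\<in>{f\<in>E. \<forall>x\<in>carrier G. 0 \<le> f x}. {m. 0 \<le> m f}) \<inter> {m. m (\<lambda>_. 1) = 1} \<inter>
      (\<Inter>f\<in>-E. {m. m f = 0})"
      unfolding means_def by auto
    also have "closed \<dots>"
      by (intro closed_Int closed_INT ballI closed_Collect_eq closed_Collect_le continuous_intros
          continuous_on_product_coordinates)
    finally show ?thesis .
  qed
  then have "compact (?Q \<inter> means G T)"
    using Q by (intro compact_Int_closed)
  moreover have "?Q \<inter> means G T = means G T" using sub by blast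
  ultimately show ?thesis by simp
qed

text \<open>Moving g changes m (f (g \<otimes> x)) by at most a sup norm, uniformly over all means
  m; moving m with g fixed is controlled by one coordinate. Each change gets \<epsilon>/2.\<close>

lemma act_continuous:
  "continuous_map (prod_topology T (subtopology euclidean (means G T)))
     (subtopology euclidean (means G T)) (\<lambda>(g, m). act g m)"
proof -
  let ?S = "subtopology euclidean (means G T)" and ?X = "prod_topology T (subtopology euclidean (means G T))"
  have "continuous_map ?X euclideanreal (\<lambda>z. act (fst z) (snd z) f)" for f
  proof (cases "f \<in> E")
    case False
    have "continuous_map ?X euclideanreal (\<lambda>z. 0)" by simp
    then show ?thesis
      by (rule continuous_map_eq) (use False in \<open>auto simp: act_def\<close>)
  next
    case f: True
    have "continuous_map ?X Met_TC.mtopology (\<lambda>z. act (fst z) (snd z) f)"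
      unfolding Met_TC.continuous_map_to_metric
    proof (intro ballI allI impI)
      fix z0 :: "'a \<times> (('a \<Rightarrow> real) \<Rightarrow> real)" and \<epsilon> :: real
      assume "z0 \<in> topspace ?X" and \<epsilon>: "\<epsilon> > 0"
      then obtain g0 m0 where z0: "z0 = (g0, m0)" "g0 \<in> carrier G" "m0 \<in> means G T"
        using topspace by (cases z0) auto
      have "\<epsilon>/2 > 0" using \<epsilon> by simp
      then obtain U where U: "openin T U" "g0 \<in> U"
        "\<forall>h\<in>U. \<forall>x\<in>carrier G. \<bar>f (h \<otimes> x) - f (g0 \<otimes> x)\<bar> \<le> \<epsilon>/2"
        using f z0 unfolding left_unif_cont_def by blast
      let ?f0 = "\<lambda>x. f (g0 \<otimes> x)"
      have f0: "?f0 \<in> E" using translate_in_E[OF f] z0 by blast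
      have "open {m. \<bar>m ?f0 - m0 ?f0\<bar> < \<epsilon>/2}"
        by (intro open_Collect_less continuous_intros continuous_on_product_coordinates)
      then have V: "openin ?S (means G T \<inter> {m. \<bar>m ?f0 - m0 ?f0\<bar> < \<epsilon>/2})"
        by (simp add: openin_open_Int)
      show "\<exists>U. openin ?X U \<and> z0 \<in> U \<and> (\<forall>z\<in>U. act (fst z) (snd z) f \<in> Met_TC.mball (act (fst z0) (snd z0) f) \<epsilon>)"
      proof (intro exI conjI ballI)
        let ?U = "U \<times> (means G T \<inter> {m. \<bar>m ?f0 - m0 ?f0\<bar> < \<epsilon>/2})"
        show "openin ?X ?U" using U(1) V by (simp add: openin_prod_Times_iff)
        show "z0 \<in> ?U" using z0 U \<epsilon> by simp
        fix z assume "z \<in> ?U"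
        then obtain g m where z: "z = (g, m)" "g \<in> U" "m \<in> means G T" "\<bar>m ?f0 - m0 ?f0\<bar> < \<epsilon>/2"
          by auto
        have g: "g \<in> carrier G" using z(2) U(1) openin_subset topspace by blast
        have "\<bar>m (\<lambda>x. f (g \<otimes> x)) - m ?f0\<bar> \<le> \<epsilon>/2"
          using U(3) z(2) f0 translate_in_E[OF f g] by (intro means_dist[OF z(3)]) auto
        then have "\<bar>m (\<lambda>x. f (g \<otimes> x)) - m0 ?f0\<bar> < \<epsilon>" using z(4) by linarith
        then show "act (fst z) (snd z) f \<in> Met_TC.mball (act (fst z0) (snd z0) f) \<epsilon>"
          using z z0 f by (simp add: act_def dist_real_def abs_minus_commute)
      qed
    qed
    then show ?thesis by simp
  qed
  then have "continuous_map ?X euclidean (\<lambda>z. act (fst z) (snd z))"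
    unfolding euclidean_product_topology[symmetric] continuous_map_componentwise_UNIV by simp
  then have "continuous_map ?X ?S (\<lambda>z. act (fst z) (snd z))"
    using act_in topspace by (auto simp: continuous_map_in_subtopology)
  then show ?thesis by (simp add: case_prod_unfold)
qed

theorem amenable_imp_invariant_mean:
  assumes "amenable G T"
  obtains m where "m \<in> means G T" "\<And>g f. g \<in> carrier G \<Longrightarrow> f \<in> E \<Longrightarrow> m (\<lambda>x. f (g \<otimes> x)) = m f"
proof -
  let ?V = "fun_module :: (real, ('a \<Rightarrow> real) \<Rightarrow> real) module"
  have conv: "(\<lambda>f. (1 - t) * x f + t * y f) \<in> means G T"
    if "x \<in> means G T" "y \<in> means G T" "0 \<le> t" "t \<le> 1" for x y and t :: real
  proof -
    have "0 \<le> (1 - t) * x f + t * y f" if "f \<in> E" "\<forall>z\<in>carrier G. 0 \<le> f z" for f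
      using means_nonneg[of _ f] that \<open>x \<in> means G T\<close> \<open>y \<in> means G T\<close> \<open>0 \<le> t\<close> \<open>t \<le> 1\<close> by simp
    then show ?thesis
      using that(1,2) unfolding means_def by (auto simp: algebra_simps)
  qed
  \<comment> \<open>Evaluation at the identity is a mean.\<close>
  have "(\<lambda>f. if f \<in> E then f \<one> else 0) \<in> means G T"
    unfolding means_def using add_in_E scale_in_E const_in_E by auto
  then have ne: "means G T \<noteq> {}" by blast
  have cx: "convex_in ?V (means G T)"
    unfolding convex_in_def using conv by (auto simp: fun_module_def)
  have "continuous_affine_action G T ?V euclidean (means G T) act"
    unfolding continuous_affine_action_def
  proof (intro conjI group_action_act act_continuous ballI)
    fix g x y and t :: real
    assume "g \<in> carrier G" "x \<in> means G T" "y \<in> means G T" "t \<in> {0..1}"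
    then show "act g ((1 - t) \<odot>\<^bsub>?V\<^esub> x \<oplus>\<^bsub>?V\<^esub> t \<odot>\<^bsub>?V\<^esub> y) = (1 - t) \<odot>\<^bsub>?V\<^esub> act g x \<oplus>\<^bsub>?V\<^esub> t \<odot>\<^bsub>?V\<^esub> act g y"
      using conv[of x y t] by (auto simp: act_def fun_module_def)
  qed
  then obtain m where m: "m \<in> means G T" "\<And>g. g \<in> carrier G \<Longrightarrow> act g m = m"
    using assms locally_convex_fun_module ne compact_means cx unfolding amenable_def
    by (metis compactin_euclidean_iff)
  show thesis
  proof (rule that[OF m(1)])
    fix g f assume "g \<in> carrier G" "f \<in> E"
    then show "m (\<lambda>x. f (g \<otimes> x)) = m f"
      using fun_cong[OF m(2), of g f] m(1) by (simp add: act_def)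
  qed
qed

end

section \<open>The uniform topology on the automorphism group\<close>

lemma borel_automorphisms_bij:
  assumes "f \<in> borel_automorphisms M"
  shows "bij_betw f (space M) (space M)" "f \<in> measurable M M" "inv_into (space M) f \<in> measurable M M"
    "distr M M f = M" "f \<in> Bij (space M)"
  using assms unfolding borel_automorphisms_def Bij_def by auto

lemma borel_automorphismsI:
  assumes bij: "bij_betw f (space M) (space M)" and f: "f \<in> measurable M M" and g: "g \<in> measurable M M"
    and fg: "\<And>x. x \<in> space M \<Longrightarrow> f (g x) = x" and d: "distr M M f = M"
  shows "restrict f (space M) \<in> borel_automorphisms M"
proof -
  let ?f = "restrict f (space M)"
  have eq: "inv_into (space M) ?f x = g x" if "x \<in> space M" for x
  proof (rule inv_into_f_eq)
    show "inj_on ?f (space M)" using bij by (simp add: bij_betw_def)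
    show "g x \<in> space M" using g that by (rule measurable_space)
    then show "?f (g x) = x" using fg that by simp
  qed
  have "?f \<in> measurable M M"
    using f by (simp cong: measurable_cong)
  moreover have "inv_into (space M) ?f \<in> measurable M M"
    using g eq by (simp cong: measurable_cong)
  moreover have "distr M M ?f = M"
    using d distr_cong[of M M M M ?f f] by simp
  moreover have "?f \<in> Bij (space M)"
    using bij by (simp add: Bij_def)
  ultimately show ?thesis unfolding borel_automorphisms_def by simp
qed

lemma borel_automorphisms_id: "(\<lambda>x\<in>space M. x) \<in> borel_automorphisms M"
  by (rule borel_automorphismsI[where g = "\<lambda>x. x"]) (auto simp: distr_id2 bij_betw_def)

lemma borel_automorphisms_compose:
  assumes f: "f \<in> borel_automorphisms M" and g: "g \<in> borel_automorphisms M"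
  shows "compose (space M) f g \<in> borel_automorphisms M"
proof -
  note F = borel_automorphisms_bij[OF f] and G = borel_automorphisms_bij[OF g]
  have "restrict (f \<circ> g) (space M) \<in> borel_automorphisms M"
  proof (rule borel_automorphismsI[where g = "inv_into (space M) g \<circ> inv_into (space M) f"])
    show "bij_betw (f \<circ> g) (space M) (space M)" using F(1) G(1) by (rule bij_betw_trans[rotated])
    show "f \<circ> g \<in> measurable M M" using F(2) G(2) by (rule measurable_comp[rotated])
    show "inv_into (space M) g \<circ> inv_into (space M) f \<in> measurable M M" using F(3) G(3) by (rule measurable_comp)
    show "(f \<circ> g) ((inv_into (space M) g \<circ> inv_into (space M) f) x) = x" if "x \<in> space M" for x
      using that F(1,3) G(1) measurable_space[OF F(3) that]
      by (simp add: bij_betw_inv_into_right)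
    show "distr M M (f \<circ> g) = M"
      using distr_distr[OF F(2) G(2)] unfolding F(4) G(4) by simp
  qed
  then show ?thesis by (simp add: compose_def restrict_def o_def)
qed

definition aut_inv :: "'a measure \<Rightarrow> ('a \<Rightarrow> 'a) \<Rightarrow> 'a \<Rightarrow> 'a" where
  "aut_inv M f = restrict (inv_into (space M) f) (space M)"

lemma aut_inv:
  assumes f: "f \<in> borel_automorphisms M"
  shows "aut_inv M f \<in> borel_automorphisms M"
    "\<And>x. x \<in> space M \<Longrightarrow> aut_inv M f (f x) = x" "\<And>x. x \<in> space M \<Longrightarrow> f (aut_inv M f x) = x"
proof -
  note F = borel_automorphisms_bij[OF f]
  have 1: "inv_into (space M) f (f x) = x" if "x \<in> space M" for x
    using F(1) that by (rule bij_betw_inv_into_left)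
  have "distr M M (inv_into (space M) f) = distr (distr M M f) M (inv_into (space M) f)"
    unfolding F(4) ..
  also have "\<dots> = distr M M (\<lambda>x. x)"
    unfolding distr_distr[OF F(3,2)] by (rule distr_cong) (auto simp: 1)
  finally have "distr M M (inv_into (space M) f) = M"
    by (simp add: distr_id2)
  with F 1 show "aut_inv M f \<in> borel_automorphisms M"
    unfolding aut_inv_def by (intro borel_automorphismsI[where g = f]) (auto simp: bij_betw_inv_into)
  show "aut_inv M f (f x) = x" if "x \<in> space M" for x
    using 1[OF that] measurable_space[OF F(2) that] by (simp add: aut_inv_def)
  show "f (aut_inv M f x) = x" if "x \<in> space M" for x
    using bij_betw_inv_into_right[OF F(1) that] that by (simp add: aut_inv_def)
qed

lemma AE_borel_automorphism:
  assumes "f \<in> borel_automorphisms M" "AE x in M. Q x"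
  shows "AE x in M. Q (f x)"
  using AE_distrD[OF borel_automorphisms_bij(2)[OF assms(1)], of Q] assms
  unfolding borel_automorphisms_bij(4)[OF assms(1)] by blast

section \<open>Automorphisms modulo null sets\<close>

lemma equiv_ae_eq: "equiv (borel_automorphisms M) (ae_eq M)"
proof (rule equivI)
  show "refl_on (borel_automorphisms M) (ae_eq M)"
    by (rule refl_onI) (auto simp: ae_eq_def)
  show "sym (ae_eq M)"
    by (rule symI) (auto simp: ae_eq_def eq_commute)
  show "trans (ae_eq M)"
  proof (rule transI)
    fix f g h assume "(f, g) \<in> ae_eq M" "(g, h) \<in> ae_eq M"
    moreover from this have "AE x in M. f x = g x" "AE x in M. g x = h x"
      by (auto simp: ae_eq_def)
    then have "AE x in M. f x = h x" by eventually_elim simp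
    ultimately show "(f, h) \<in> ae_eq M" by (auto simp: ae_eq_def)
  qed
qed (auto simp: ae_eq_def)

abbreviation aut_class :: "'a measure \<Rightarrow> ('a \<Rightarrow> 'a) \<Rightarrow> ('a \<Rightarrow> 'a) set" where
  "aut_class M f \<equiv> ae_eq M `` {f}"

abbreviation aut_rep :: "('a \<Rightarrow> 'a) set \<Rightarrow> 'a \<Rightarrow> 'a" where
  "aut_rep S \<equiv> SOME f. f \<in> S"

lemma aut_class_eq_iff:
  assumes "f \<in> borel_automorphisms M" "g \<in> borel_automorphisms M"
  shows "aut_class M f = aut_class M g \<longleftrightarrow> (AE x in M. f x = g x)"
  using eq_equiv_class_iff[OF equiv_ae_eq assms] assms by (auto simp: ae_eq_def)

lemma aut_class_in: "f \<in> borel_automorphisms M \<Longrightarrow> aut_class M f \<in> carrier (Aut M)"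
  by (simp add: Aut_def quotientI)

lemma aut_rep:
  assumes "S \<in> carrier (Aut M)"
  shows "aut_rep S \<in> borel_automorphisms M" "aut_class M (aut_rep S) = S"
proof -
  obtain f where f: "f \<in> borel_automorphisms M" "S = aut_class M f"
    using assms by (auto simp: Aut_def elim: quotientE)
  then have "f \<in> S" using equiv_class_self[OF equiv_ae_eq] by blast
  then have "aut_rep S \<in> S" by (rule someI[of "\<lambda>f. f \<in> S"])
  then have "(f, aut_rep S) \<in> ae_eq M" using f by blast
  then show "aut_rep S \<in> borel_automorphisms M" "aut_class M (aut_rep S) = S"
    using f equiv_class_eq[OF equiv_ae_eq] by (auto simp: ae_eq_def)
qed

lemma AE_aut_rep:
  assumes "f \<in> borel_automorphisms M"
  shows "AE x in M. aut_rep (aut_class M f) x = f x"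
  using aut_rep[OF aut_class_in[OF assms]] aut_class_eq_iff[OF _ assms] by blast

lemma Aut_mult:
  assumes f: "f \<in> borel_automorphisms M" and g: "g \<in> borel_automorphisms M"
  shows "aut_class M f \<otimes>\<^bsub>Aut M\<^esub> aut_class M g = aut_class M (compose (space M) f g)"
proof -
  have "congruent2 (ae_eq M) (ae_eq M) (\<lambda>f g. aut_class M (compose (space M) f g))"
  proof (rule congruent2I')
    fix f f' g g' assume "(f, f') \<in> ae_eq M" "(g, g') \<in> ae_eq M"
    then have in_B: "f \<in> borel_automorphisms M" "f' \<in> borel_automorphisms M"
      "g \<in> borel_automorphisms M" "g' \<in> borel_automorphisms M"
      and ae: "AE x in M. f x = f' x" "AE x in M. g x = g' x"
      by (auto simp: ae_eq_def)
    \<comment> \<open>As g preserves the measure, the null set where f and f' differ pulls back to a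
      null set.\<close>
    have "AE x in M. f (g x) = f' (g x)"
      using AE_borel_automorphism[OF in_B(3) ae(1)] .
    then have "AE x in M. compose (space M) f g x = compose (space M) f' g' x"
      using ae(2) AE_space by eventually_elim (simp add: compose_def)
    then show "aut_class M (compose (space M) f g) = aut_class M (compose (space M) f' g')"
      using in_B by (subst aut_class_eq_iff) (auto intro: borel_automorphisms_compose)
  qed
  from UN_equiv_class2[OF equiv_ae_eq equiv_ae_eq this f g] show ?thesis
    by (simp add: Aut_def)
qed

lemma Aut_cases:
  assumes "S \<in> carrier (Aut M)"
  obtains f where "f \<in> borel_automorphisms M" "S = aut_class M f"
  using aut_rep[OF assms] by metis

lemma group_Aut: "group (Aut M)"
proof (rule groupI)
  have one: "\<one>\<^bsub>Aut M\<^esub> = aut_class M (\<lambda>x\<in>space M. x)"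
    by (simp add: Aut_def)
  show "\<one>\<^bsub>Aut M\<^esub> \<in> carrier (Aut M)"
    unfolding one by (intro aut_class_in borel_automorphisms_id)
  fix S assume "S \<in> carrier (Aut M)"
  then obtain f where f: "f \<in> borel_automorphisms M" "S = aut_class M f" by (rule Aut_cases)
  have "compose (space M) (\<lambda>x\<in>space M. x) f = f"
    using borel_automorphisms_bij(5)[OF f(1)] by (simp add: Bij_imp_extensional Bij_imp_funcset)
  then show "\<one>\<^bsub>Aut M\<^esub> \<otimes>\<^bsub>Aut M\<^esub> S = S"
    using f by (simp add: one Aut_mult borel_automorphisms_id)
  have "compose (space M) (aut_inv M f) f = (\<lambda>x\<in>space M. x)"
    using aut_inv(2)[OF f(1)] by (auto simp: compose_def restrict_def)
  then show "\<exists>S'\<in>carrier (Aut M). S' \<otimes>\<^bsub>Aut M\<^esub> S = \<one>\<^bsub>Aut M\<^esub>"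
    using f by (intro bexI[of _ "aut_class M (aut_inv M f)"]) (auto simp: one Aut_mult aut_inv aut_class_in)
next
  fix S T assume "S \<in> carrier (Aut M)" "T \<in> carrier (Aut M)"
  then show "S \<otimes>\<^bsub>Aut M\<^esub> T \<in> carrier (Aut M)"
    by (metis Aut_cases Aut_mult aut_class_in borel_automorphisms_compose)
next
  fix S T U assume "S \<in> carrier (Aut M)" "T \<in> carrier (Aut M)" "U \<in> carrier (Aut M)"
  then obtain f g h where fgh: "f \<in> borel_automorphisms M" "g \<in> borel_automorphisms M"
    "h \<in> borel_automorphisms M" "S = aut_class M f" "T = aut_class M g" "U = aut_class M h"
    by (metis Aut_cases)
  have "compose (space M) (compose (space M) f g) h = compose (space M) f (compose (space M) g h)"
    using measurable_space[OF borel_automorphisms_bij(2)[OF fgh(3)]] by (auto simp: compose_def restrict_def)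
  then show "S \<otimes>\<^bsub>Aut M\<^esub> T \<otimes>\<^bsub>Aut M\<^esub> U = S \<otimes>\<^bsub>Aut M\<^esub> (T \<otimes>\<^bsub>Aut M\<^esub> U)"
    using fgh by (simp add: Aut_mult borel_automorphisms_compose)
qed

text \<open>An injective Borel code turns equality of points into equality of two real-valued
  measurable functions.\<close>

lemma standard_borel_diagonal:
  fixes M :: "'a measure"
  assumes std: "standard_borel M" and f: "f \<in> measurable N M" and g: "g \<in> measurable N M"
  shows "{x \<in> space N. f x = g x} \<in> sets N"
proof (cases "space M = {}")
  case True
  then have "space N = {}" using measurable_space[OF f] by blast
  then show ?thesis by simp
next
  case False
  obtain \<rho> :: "'a \<Rightarrow> real" and \<kappa> :: "real \<Rightarrow> 'a" where \<rho>: "\<rho> \<in> borel_measurable M"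
    and \<kappa>: "\<And>x. x \<in> space M \<Longrightarrow> \<kappa> (\<rho> x) = x"
    using standard_borel_embedding[OF std False] by blast
  have [measurable]: "(\<lambda>x. \<rho> (f x)) \<in> borel_measurable N" "(\<lambda>x. \<rho> (g x)) \<in> borel_measurable N"
    using measurable_compose[OF f \<rho>] measurable_compose[OF g \<rho>] .
  have "f x = g x \<longleftrightarrow> \<rho> (f x) = \<rho> (g x)" if "x \<in> space N" for x
    using \<kappa>[OF measurable_space[OF f that]] \<kappa>[OF measurable_space[OF g that]] by metis
  then have "{x \<in> space N. f x = g x} = {x \<in> space N. \<rho> (f x) = \<rho> (g x)}" by blast
  also have "\<dots> \<in> sets N" by measurable
  finally show ?thesis .
qed

locale borel_aut =
  fixes M \<nu> :: "'a measure"
  assumes std: "standard_borel M" and equivalent: "equivalent_prob M \<nu>"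
begin

sublocale \<nu>: prob_space \<nu>
  using equivalent by (simp add: equivalent_prob_def)

lemma sets_\<nu>: "sets \<nu> = sets M" and space_\<nu>: "space \<nu> = space M"
  using equivalent sets_eq_imp_space_eq by (auto simp: equivalent_prob_def)

lemma AE_\<nu>: "(AE x in \<nu>. Q x) \<longleftrightarrow> (AE x in M. Q x)"
  using equivalent space_\<nu> by (simp add: eventually_ae_filter equivalent_prob_def)

section \<open>The uniform metric and left translations\<close>

definition disagree :: "('a \<Rightarrow> 'a) \<Rightarrow> ('a \<Rightarrow> 'a) \<Rightarrow> 'a set" where
  "disagree f g = {x \<in> space M. f x \<noteq> g x}"

lemma disagree_sets:
  assumes "f \<in> borel_automorphisms M" "g \<in> borel_automorphisms M"
  shows "disagree f g \<in> sets M"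
proof -
  have "disagree f g = space M - {x \<in> space M. f x = g x}" by (auto simp: disagree_def)
  then show ?thesis
    using standard_borel_diagonal[OF std borel_automorphisms_bij(2)[OF assms(1)]
        borel_automorphisms_bij(2)[OF assms(2)]] by auto
qed

lemma uniform_dist_class:
  assumes f: "f \<in> borel_automorphisms M" and g: "g \<in> borel_automorphisms M"
  shows "uniform_dist \<nu> (aut_class M f) (aut_class M g) = measure \<nu> (disagree f g)"
proof -
  let ?f = "aut_rep (aut_class M f)" and ?g = "aut_rep (aut_class M g)"
  have "AE x in \<nu>. ?f x = f x" "AE x in \<nu>. ?g x = g x"
    unfolding AE_\<nu> by (rule AE_aut_rep[OF f], rule AE_aut_rep[OF g])
  then have "AE x in \<nu>. x \<in> disagree ?f ?g \<longleftrightarrow> x \<in> disagree f g"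
    by eventually_elim (simp add: disagree_def)
  then have "measure \<nu> (disagree ?f ?g) = measure \<nu> (disagree f g)"
    by (rule \<nu>.finite_measure_eq_AE; unfold sets_\<nu>; intro disagree_sets aut_rep aut_class_in f g)
  then show ?thesis
    by (simp add: uniform_dist_def disagree_def space_\<nu>)
qed

sublocale Metric_space "carrier (Aut M)" "uniform_dist \<nu>"
proof
  fix S T U
  show "0 \<le> uniform_dist \<nu> S T" by (simp add: uniform_dist_def)
  show "uniform_dist \<nu> S T = uniform_dist \<nu> T S" by (simp add: uniform_dist_def eq_commute)
  assume "S \<in> carrier (Aut M)" "T \<in> carrier (Aut M)"
  then obtain f g where fg: "f \<in> borel_automorphisms M" "g \<in> borel_automorphisms M"
    "S = aut_class M f" "T = aut_class M g" by (metis Aut_cases)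
  have "uniform_dist \<nu> S T = 0 \<longleftrightarrow> emeasure \<nu> (disagree f g) = 0"
    using fg by (simp add: uniform_dist_class \<nu>.emeasure_eq_measure)
  also have "\<dots> \<longleftrightarrow> (AE x in \<nu>. f x = g x)"
    using AE_iff_measurable[of "disagree f g" \<nu> "\<lambda>x. f x = g x"] disagree_sets[OF fg(1,2)]
    by (simp add: sets_\<nu> space_\<nu> disagree_def)
  finally show "uniform_dist \<nu> S T = 0 \<longleftrightarrow> S = T"
    using fg by (simp add: aut_class_eq_iff AE_\<nu>)
  assume "U \<in> carrier (Aut M)"
  then obtain h where h: "h \<in> borel_automorphisms M" "U = aut_class M h" by (metis Aut_cases)
  have "measure \<nu> (disagree f h) \<le> measure \<nu> (disagree f g \<union> disagree g h)"
    using fg h by (intro \<nu>.finite_measure_mono) (auto simp: disagree_def sets_\<nu> intro!: disagree_sets[unfolded disagree_def])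
  also have "\<dots> \<le> measure \<nu> (disagree f g) + measure \<nu> (disagree g h)"
    using fg h by (intro measure_Un_le) (auto simp: sets_\<nu> intro!: disagree_sets)
  finally show "uniform_dist \<nu> S U \<le> uniform_dist \<nu> S T + uniform_dist \<nu> T U"
    using fg h by (simp add: uniform_dist_class)
qed

text \<open>An injective map applied afterwards leaves the disagreement set unchanged.
  Multiplication on the right would move that set, and \<nu> is not assumed invariant.\<close>

lemma uniform_dist_left_invariant:
  assumes "S \<in> carrier (Aut M)" "T \<in> carrier (Aut M)" "U \<in> carrier (Aut M)"
  shows "uniform_dist \<nu> (U \<otimes>\<^bsub>Aut M\<^esub> S) (U \<otimes>\<^bsub>Aut M\<^esub> T) = uniform_dist \<nu> S T"
proof -
  obtain f g h where fgh: "f \<in> borel_automorphisms M" "g \<in> borel_automorphisms M"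
    "h \<in> borel_automorphisms M" "S = aut_class M f" "T = aut_class M g" "U = aut_class M h"
    using assms by (metis Aut_cases)
  have "h (f x) = h (g x) \<longleftrightarrow> f x = g x" if "x \<in> space M" for x
    using aut_inv(2)[OF fgh(3)] measurable_space[OF borel_automorphisms_bij(2)] fgh that by metis
  then have "disagree (compose (space M) h f) (compose (space M) h g) = disagree f g"
    by (auto simp: disagree_def compose_def)
  then show ?thesis
    using fgh by (simp add: Aut_mult uniform_dist_class borel_automorphisms_compose)
qed

sublocale semitop_group "Aut M" "uniform_topology M \<nu>"
proof (intro semitop_group.intro semitop_group_axioms.intro group_Aut)
  interpret group "Aut M" by (rule group_Aut)
  have top: "uniform_topology M \<nu> = mtopology" by (simp add: uniform_topology_def)
  show "topspace (uniform_topology M \<nu>) = carrier (Aut M)" by (simp add: top)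
  fix h assume h: "h \<in> carrier (Aut M)"
  show "continuous_map (uniform_topology M \<nu>) (uniform_topology M \<nu>) (\<lambda>g. h \<otimes>\<^bsub>Aut M\<^esub> g)"
    unfolding top continuous_map_to_metric
  proof (intro ballI allI impI)
    fix g and \<epsilon> :: real assume g: "g \<in> topspace mtopology" and "\<epsilon> > 0"
    then show "\<exists>U. openin mtopology U \<and> g \<in> U \<and> (\<forall>g'\<in>U. h \<otimes>\<^bsub>Aut M\<^esub> g' \<in> mball (h \<otimes>\<^bsub>Aut M\<^esub> g) \<epsilon>)"
      using h by (intro exI[of _ "mball g \<epsilon>"]) (auto simp: uniform_dist_left_invariant)
  qed
qed

end

section \<open>A Bernoulli action of a non-amenable permutation group\<close>

text \<open>Two permutations of the natural numbers without a common invariant mean: with \<open>A\<close> the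
  set of multiples of 3, \<open>flip\<close> exchanges \<open>A\<close> with its complement, while \<open>A\<close> and its images
  under \<open>turn\<close> partition the natural numbers into three sets.\<close>

definition flip :: "nat \<Rightarrow> nat" where
  "flip n = (if n mod 3 = 0 then 3 * (n div 6) + 1 + n div 3 mod 2
             else if n mod 3 = 1 then 6 * (n div 3) else 6 * (n div 3) + 3)"

definition turn :: "nat \<Rightarrow> nat" where
  "turn n = (if n mod 3 = 2 then n - 2 else n + 1)"

text \<open>The even and the odd multiples of 3 are paired with the residue classes 1 and 2
  respectively.\<close>

lemma flip_simps:
  "flip (6 * k) = 3 * k + 1" "flip (6 * k + 3) = 3 * k + 2" "flip (3 * k + 1) = 6 * k" "flip (3 * k + 2) = 6 * k + 3"
proof -
  have "(6 * k + 3) mod 3 = 0" "(6 * k) mod 3 = 0" "(3 * k + 1) mod 3 = 1" "(3 * k + 2) mod 3 = 2"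
    "(6 * k) div 6 = k" "(6 * k + 3) div 6 = k" "(6 * k) div 3 mod 2 = 0" "(6 * k + 3) div 3 mod 2 = 1"
    "(3 * k + 1) div 3 = k" "(3 * k + 2) div 3 = k"
    by presburger+
  then show "flip (6 * k) = 3 * k + 1" "flip (6 * k + 3) = 3 * k + 2" "flip (3 * k + 1) = 6 * k" "flip (3 * k + 2) = 6 * k + 3"
    by (simp_all only: flip_def) simp_all
qed

lemma flip_flip: "flip \<circ> flip = id"
proof
  fix n :: nat
  have "(\<exists>k. n = 6 * k) \<or> (\<exists>k. n = 6 * k + 3) \<or> (\<exists>k. n = 3 * k + 1) \<or> (\<exists>k. n = 3 * k + 2)"
    by presburger
  then show "(flip \<circ> flip) n = id n"
    by (elim disjE exE) (simp_all only: comp_def id_def flip_simps)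
qed

lemma turn_simps: "turn (3 * k) = 3 * k + 1" "turn (3 * k + 1) = 3 * k + 2" "turn (3 * k + 2) = 3 * k"
  unfolding turn_def by presburger+

lemma turn_turn_turn: "turn \<circ> turn \<circ> turn = id"
proof
  fix n :: nat
  have "(\<exists>k. n = 3 * k) \<or> (\<exists>k. n = 3 * k + 1) \<or> (\<exists>k. n = 3 * k + 2)"
    by presburger
  then show "(turn \<circ> turn \<circ> turn) n = id n"
    by (elim disjE exE) (simp_all only: comp_def id_def turn_simps)
qed

lemma flip_vimage: "flip -` {n. n mod 3 = 0} = - {n. n mod 3 = 0}"
proof -
  have "flip n mod 3 = 0 \<longleftrightarrow> n mod 3 \<noteq> 0" for n
    unfolding flip_def by presburger
  then show ?thesis by auto
qed

lemma turn_vimage: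
  "turn -` {n. n mod 3 = 0} = {n. n mod 3 = 2}" "turn -` {n. n mod 3 = 2} = {n. n mod 3 = 1}"
proof -
  have "turn n mod 3 = (n + 1) mod 3" for n
  proof -
    have "(\<exists>k. n = 3 * k) \<or> (\<exists>k. n = 3 * k + 1) \<or> (\<exists>k. n = 3 * k + 2)"
      by presburger
    then show ?thesis
      by (elim disjE exE) (simp_all only: turn_simps, presburger+)
  qed
  moreover have "(n + 1) mod 3 = 0 \<longleftrightarrow> n mod 3 = 2" "(n + 1) mod 3 = 2 \<longleftrightarrow> n mod 3 = 1" for n :: nat
    by presburger+
  ultimately show "turn -` {n. n mod 3 = 0} = {n. n mod 3 = 2}" "turn -` {n. n mod 3 = 2} = {n. n mod 3 = 1}"
    by auto
qed

fun word :: "bool list \<Rightarrow> nat \<Rightarrow> nat" where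
  "word [] = id"
| "word (b # bs) = (if b then flip else turn) \<circ> word bs"

definition perms :: "(nat \<Rightarrow> nat) set" where
  "perms = range word"

lemma word_append: "word (xs @ ys) = word xs \<circ> word ys"
  by (induction xs) (auto simp: o_assoc)

lemma flip_in_perms: "flip \<in> perms" and turn_in_perms: "turn \<in> perms"
  unfolding perms_def using rangeI[of word "[True]"] rangeI[of word "[False]"] by simp_all

text \<open>Words in the two generators already form a group: \<open>flip\<close> is its own inverse
  and the inverse of \<open>turn\<close> is its square, which is the word \<open>c\<close> of the
  proof.\<close>

lemma word_inverse: "\<exists>ys. word xs \<circ> word ys = id \<and> word ys \<circ> word xs = id"
proof (induction xs)
  case Nil
  show ?case by (rule exI[of _ "[]"]) simp
next
  case (Cons b xs)
  then obtain ys where ys: "word xs \<circ> word ys = id" "word ys \<circ> word xs = id" by blast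
  define c where "c = (if b then [True] else [False, False])"
  have c: "(if b then flip else turn) \<circ> word c = id" "word c \<circ> (if b then flip else turn) = id"
    using flip_flip turn_turn_turn by (auto simp: c_def o_assoc)
  let ?g = "if b then flip else turn"
  have "word (b # xs) \<circ> word (ys @ c) = ?g \<circ> (word xs \<circ> word ys) \<circ> word c"
    by (simp only: word_append word.simps o_assoc)
  moreover have "word (ys @ c) \<circ> word (b # xs) = word ys \<circ> (word c \<circ> ?g) \<circ> word xs"
    by (simp only: word_append word.simps o_assoc)
  ultimately show ?case using ys c by (metis comp_id)
qed

section \<open>The i.i.d. product space and its shift\<close>

abbreviation bernoulli :: "(nat \<Rightarrow> real) measure" where
  "bernoulli \<equiv> Pi\<^sub>M UNIV (\<lambda>_. uniform01)"

interpretation bernoulli: product_prob_space "\<lambda>_::nat. uniform01" UNIV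
  by (rule product_prob_spaceI) (rule prob_space_uniform01)

lemma space_bernoulli: "space bernoulli = UNIV"
  by (simp add: space_PiM)

lemma standard_borel_bernoulli: "standard_borel bernoulli"
  unfolding standard_borel_def
proof (intro exI conjI)
  show "topspace euclidean = space bernoulli"
    by (simp add: space_bernoulli)
  show "completely_metrizable_space (euclidean :: (nat \<Rightarrow> real) topology)"
    unfolding euclidean_product_topology[symmetric] completely_metrizable_space_product_topology
    by (auto intro: completely_metrizable_space_euclidean)
  obtain B :: "(nat \<Rightarrow> real) set set" where B: "countable B" "topological_basis B"
    using ex_countable_basis by blast
  have "\<exists>V\<in>B. x \<in> V \<and> V \<subseteq> U" if "openin euclidean U \<and> x \<in> U" for U x
    using topological_basisE[OF B(2), of U x] that by (metis open_openin)
  moreover have "openin euclidean V" if "V \<in> B" for V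
    using topological_basis_open[OF B(2) that] by simp
  ultimately show "second_countable (euclidean :: (nat \<Rightarrow> real) topology)"
    unfolding second_countable_def using B(1) by blast
  have "sets bernoulli = sets (Pi\<^sub>M UNIV (\<lambda>_::nat. borel :: real measure))"
    by (rule sets_PiM_cong) simp_all
  also have "\<dots> = sets borel"
    by (rule sets_PiM_equal_borel)
  finally show "sets bernoulli = sigma_sets (space bernoulli) {U. openin euclidean U}"
    by (simp add: borel_def space_bernoulli)
qed

lemma uniform01_singleton: "emeasure uniform01 {y} = 0"
  by (cases "y \<in> {0<..<1}") (auto simp: emeasure_uniform_measure)

lemma bernoulli_singleton: "measure bernoulli {\<omega>} = 0"
proof -
  have "emeasure bernoulli {\<omega>} \<le> emeasure bernoulli ((\<lambda>\<omega>. \<omega> 0) -` {\<omega> 0} \<inter> space bernoulli)"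
    by (intro emeasure_mono measurable_sets[of _ _ uniform01])
       (auto simp: space_bernoulli intro: measurable_component_singleton)
  also have "\<dots> = emeasure (distr bernoulli uniform01 (\<lambda>\<omega>. \<omega> 0)) {\<omega> 0}"
    by (rule emeasure_distr[symmetric]) (auto intro: measurable_component_singleton)
  also have "\<dots> = 0"
    using distr_PiM_component[of UNIV "\<lambda>_. uniform01" "0::nat"] prob_space_uniform01 uniform01_singleton by simp
  finally show ?thesis by (simp add: measure_def)
qed

text \<open>By Fubini: once coordinate j is fixed, the independent atomless coordinate i takes that
  value with probability 0.\<close>

lemma AE_bernoulli_coordinates:
  assumes "i \<noteq> j"
  shows "AE \<omega> in bernoulli. \<omega> i \<noteq> \<omega> j"
proof -
  let ?M = "\<lambda>_::nat. uniform01"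
  let ?J = "{i, j}"
  have meas[measurable]: "{x \<in> space (Pi\<^sub>M ?J ?M). x i = x j} \<in> sets (Pi\<^sub>M ?J ?M)"
    by measurable
  have "emeasure (Pi\<^sub>M ?J ?M) {x \<in> space (Pi\<^sub>M ?J ?M). x i = x j} =
      (\<integral>\<^sup>+x. indicator {x \<in> space (Pi\<^sub>M ?J ?M). x i = x j} x \<partial>Pi\<^sub>M (insert i {j}) ?M)"
    by simp
  also have "\<dots> = (\<integral>\<^sup>+x. (\<integral>\<^sup>+y. indicator {x \<in> space (Pi\<^sub>M ?J ?M). x i = x j} (x(i := y)) \<partial>uniform01) \<partial>Pi\<^sub>M {j} ?M)"
    using assms by (subst bernoulli.product_nn_integral_insert) auto
  also have "\<dots> \<le> (\<integral>\<^sup>+x. (\<integral>\<^sup>+y. indicator {x j} y \<partial>uniform01) \<partial>Pi\<^sub>M {j} ?M)"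
    using assms by (intro nn_integral_mono) (auto simp: indicator_def)
  also have "\<dots> = 0"
    using uniform01_singleton by simp
  finally have null: "emeasure (Pi\<^sub>M ?J ?M) {x \<in> space (Pi\<^sub>M ?J ?M). x i = x j} = 0"
    by simp
  then have "AE x in Pi\<^sub>M ?J ?M. x i \<noteq> x j"
    using meas by (intro AE_I[of _ _ "{x \<in> space (Pi\<^sub>M ?J ?M). x i = x j}"]) auto
  then have "AE x in distr bernoulli (Pi\<^sub>M ?J ?M) (\<lambda>x. restrict x ?J). x i \<noteq> x j"
    by (subst bernoulli.distr_PiM_restrict_finite) auto
  then have "AE x in bernoulli. restrict x ?J i \<noteq> restrict x ?J j"
    by (rule AE_distrD[rotated]) (intro measurable_restrict_subset, simp)
  then show ?thesis by simp
qed

interpretation shift: pmp_action bernoulli perms "\<lambda>\<sigma> \<omega>. \<omega> \<circ> \<sigma>"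
proof
  show "countable perms"
    unfolding perms_def by simp
  show "id \<in> perms"
    unfolding perms_def using rangeI[of word "[]"] by simp
  show "\<sigma> \<circ> \<tau> \<in> perms" if "\<sigma> \<in> perms" "\<tau> \<in> perms" for \<sigma> \<tau>
    using that unfolding perms_def by (auto simp flip: word_append)
  have inv: "bij \<sigma> \<and> inv_into UNIV \<sigma> \<in> perms" if \<sigma>: "\<sigma> \<in> perms" for \<sigma>
  proof -
    obtain xs where xs: "\<sigma> = word xs" using \<sigma> unfolding perms_def by blast
    then obtain ys where ys: "\<sigma> \<circ> word ys = id" "word ys \<circ> \<sigma> = id" using word_inverse by metis
    then have "bij \<sigma>" by (metis o_bij)
    moreover have "inv_into UNIV \<sigma> = word ys" using ys by (metis inv_unique_comp)
    ultimately show ?thesis unfolding perms_def by simp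
  qed
  then show "bij \<sigma>" "inv_into UNIV \<sigma> \<in> perms" if "\<sigma> \<in> perms" for \<sigma>
    using that by blast+
  show "(\<lambda>\<omega>. \<omega> \<circ> \<sigma>) \<in> measurable bernoulli bernoulli" for \<sigma>
    unfolding comp_def by (intro measurable_PiM_single') (auto simp: space_PiM)
  show "distr bernoulli bernoulli (\<lambda>\<omega>. \<omega> \<circ> \<sigma>) = bernoulli" if "\<sigma> \<in> perms" for \<sigma>
    using distr_PiM_reindex[of UNIV "\<lambda>_. uniform01" \<sigma> UNIV] prob_space_uniform01 inv[OF that]
    by (simp add: bij_is_inj comp_def restrict_UNIV)
qed auto

text \<open>An index moved by \<pi> yields two distinct coordinates, which almost surely
  differ.\<close>

lemma shift_free:
  assumes "\<pi> \<noteq> id"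
  shows "AE \<omega> in bernoulli. \<omega> \<circ> \<pi> \<noteq> \<omega>"
proof -
  obtain i where "\<pi> i \<noteq> i" using assms by (auto simp: fun_eq_iff)
  then have "AE \<omega> in bernoulli. \<omega> (\<pi> i) \<noteq> \<omega> i" by (rule AE_bernoulli_coordinates)
  then show ?thesis by eventually_elim (auto simp: fun_eq_iff)
qed

section \<open>Non-amenability\<close>

text \<open>Otherwise there are sets of N-measure below the summable bounds \<open>(1/2)^n\<close>
  with L-measure at least \<epsilon>. By Borel-Cantelli their limsup is N-null, hence L-null,
  although every tail union has L-measure at least \<epsilon>.\<close>

lemma absolutely_continuous_epsilon_delta:
  assumes L: "finite_measure L" and N: "finite_measure N" and sets: "sets L = sets N"
    and null: "null_sets N \<subseteq> null_sets L" and \<epsilon>: "\<epsilon> > 0"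
  obtains \<delta> where "\<delta> > 0" "\<And>C. C \<in> sets N \<Longrightarrow> measure N C < \<delta> \<Longrightarrow> measure L C < \<epsilon>"
proof (rule ccontr)
  interpret L: finite_measure L by fact
  interpret N: finite_measure N by fact
  assume "\<not> thesis"
  then have "\<exists>C\<in>sets N. measure N C < (1/2)^n \<and> \<epsilon> \<le> measure L C" for n :: nat
    using that[of "(1/2)^n"] by force
  then obtain C where C: "\<And>n::nat. C n \<in> sets N" "\<And>n. measure N (C n) < (1/2)^n" "\<And>n. \<epsilon> \<le> measure L (C n)"
    by metis
  have "summable (\<lambda>n. measure N (C n))"
    using C(2) by (intro summable_comparison_test'[OF summable_geometric[of "1/2::real"], of 0]) (auto intro: less_imp_le)
  then have "limsup C \<in> null_sets N"
    using C(1) by (intro borel_cantelli_limsup1) (auto simp: N.emeasure_eq_measure)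
  then have limL: "limsup C \<in> null_sets L" using null by blast
  define B where "B n = (\<Union>m\<in>{n..}. C m)" for n
  have B: "range B \<subseteq> sets L" unfolding B_def sets using C(1) by auto
  have "decseq B" unfolding B_def by (intro decseq_SucI) (auto simp: subset_eq intro: Suc_leD)
  then have "(\<lambda>n. measure L (B n)) \<longlonglongrightarrow> measure L (\<Inter>n. B n)"
    using B by (intro L.finite_Lim_measure_decseq)
  moreover have "(\<Inter>n. B n) = limsup C"
    unfolding B_def limsup_INF_SUP by auto
  moreover have "measure L (limsup C) = 0"
    using limL by (simp add: null_sets_def measure_def)
  ultimately have "(\<lambda>n. measure L (B n)) \<longlonglongrightarrow> 0" by simp
  moreover have "\<epsilon> \<le> measure L (B n)" for n
  proof -
    have "measure L (C n) \<le> measure L (B n)"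
      using B by (intro L.finite_measure_mono) (auto simp: B_def)
    then show ?thesis using C(3)[of n] by simp
  qed
  ultimately have "\<epsilon> \<le> 0" by (intro LIMSEQ_le_const) auto
  then show False using \<epsilon> by simp
qed

text \<open>P is the model of the action, \<theta> parametrises the piece \<open>X\<close> by it
  with almost inverse \<eta>, and \<rho> codes points by reals so that automorphisms become members
  of \<open>W\<close>.\<close>

locale bernoulli_factor = borel_aut M \<nu> + A: pmp_action P \<Gamma> T
  for M \<nu> :: "'a measure" and P :: "'b measure" and \<Gamma> :: "('i \<Rightarrow> 'i) set" and T +
  fixes \<theta> :: "'b \<Rightarrow> 'a" and \<eta> :: "'a \<Rightarrow> 'b" and X :: "'a set" and \<rho> :: "'a \<Rightarrow> real"
  assumes std_P: "standard_borel P"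
    and X: "X \<in> sets M" "emeasure M X \<noteq> 0" "emeasure M X \<noteq> \<infinity>"
    and iso: "ae_iso P (uniform_measure M X) \<theta> \<eta>"
    and free: "\<pi> \<in> \<Gamma> \<Longrightarrow> \<pi> \<noteq> id \<Longrightarrow> AE \<omega> in P. T \<pi> \<omega> \<noteq> \<omega>"
    and \<rho>: "\<rho> \<in> borel_measurable M" "inj_on \<rho> (space M)"
begin

section \<open>Transfer between the model and the piece \<open>X\<close>\<close>

lemma \<theta>_meas[measurable]: "\<theta> \<in> measurable P M"
  and \<eta>_meas[measurable]: "\<eta> \<in> measurable M P"
  and \<theta>_distr: "distr P M \<theta> = uniform_measure M X"
  and AE_\<eta>_\<theta>: "AE \<omega> in P. \<eta> (\<theta> \<omega>) = \<omega>"
proof -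
  have eq: "measurable P (uniform_measure M X) = measurable P M"
    "measurable (uniform_measure M X) P = measurable M P"
    by (auto intro!: measurable_cong_sets)
  show "\<theta> \<in> measurable P M" "\<eta> \<in> measurable M P" "AE \<omega> in P. \<eta> (\<theta> \<omega>) = \<omega>"
    using iso unfolding ae_iso_def eq by blast+
  have "distr P M \<theta> = distr P (uniform_measure M X) \<theta>"
    by (rule distr_cong) auto
  then show "distr P M \<theta> = uniform_measure M X"
    using iso unfolding ae_iso_def by simp
qed

lemma \<theta>_space: "\<omega> \<in> space P \<Longrightarrow> \<theta> \<omega> \<in> space M"
  using measurable_space[OF \<theta>_meas] .

lemma AE_\<theta>:
  assumes "AE x in M. x \<in> X \<longrightarrow> Q x"
  shows "AE \<omega> in P. Q (\<theta> \<omega>)"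
proof -
  have "AE x in distr P M \<theta>. Q x"
    unfolding \<theta>_distr using X(1) assms by (rule AE_uniform_measureI)
  then show ?thesis by (rule AE_distrD[OF \<theta>_meas])
qed

lemma emeasure_\<theta>:
  assumes "C \<in> sets M" "C \<subseteq> X"
  shows "emeasure M C = emeasure M X * emeasure P (\<theta> -` C \<inter> space P)"
proof -
  have "emeasure P (\<theta> -` C \<inter> space P) = emeasure M (X \<inter> C) / emeasure M X"
    using emeasure_distr[OF \<theta>_meas assms(1)] X(1) assms(1) unfolding \<theta>_distr by simp
  moreover have "X \<inter> C = C" using assms by blast
  ultimately show ?thesis
    using X by (simp add: ennreal_times_divide mult_divide_eq_ennreal ennreal_mult_divide_eq mult.commute less_top)
qed

section \<open>Lifting the permutations to automorphisms\<close>

definition good0 :: "'b set" where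
  "good0 = {\<omega> \<in> space P. \<eta> (\<theta> \<omega>) = \<omega> \<and> \<theta> \<omega> \<in> X}"

text \<open>Intersecting over the countable \<Gamma> makes the conull set invariant at every point,
  so that the lifts become genuine bijections and not just bijections modulo null sets.\<close>

definition good :: "'b set" where
  "good = {\<omega> \<in> space P. \<forall>\<sigma>\<in>\<Gamma>. T \<sigma> \<omega> \<in> good0}"

text \<open>This is the image of \<open>good\<close> under \<theta>; there \<theta> and \<eta> are
  mutually inverse bijections.\<close>

definition X' :: "'a set" where
  "X' = {x \<in> X. \<eta> x \<in> good \<and> \<theta> (\<eta> x) = x}"

lemma AE_good: "AE \<omega> in P. \<omega> \<in> good"
proof -
  have "AE \<omega> in P. \<theta> \<omega> \<in> X" by (rule AE_\<theta>) simp
  then have 0: "AE \<omega> in P. \<omega> \<in> good0"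
    using AE_\<eta>_\<theta> AE_space by eventually_elim (simp add: good0_def)
  have "AE \<omega> in P. \<forall>\<sigma>\<in>\<Gamma>. T \<sigma> \<omega> \<in> good0"
    unfolding AE_ball_countable[OF A.countable_\<Gamma>] using A.AE_T[OF _ 0] by blast
  then show ?thesis using AE_space by eventually_elim (simp add: good_def)
qed

lemma good_sub:
  assumes "\<omega> \<in> good"
  shows "\<omega> \<in> space P" "\<eta> (\<theta> \<omega>) = \<omega>" "\<theta> \<omega> \<in> X" "\<theta> \<omega> \<in> X'"
proof -
  have "\<omega> \<in> good0" using assms A.id_in A.T_id unfolding good_def by force
  with assms show "\<omega> \<in> space P" "\<eta> (\<theta> \<omega>) = \<omega>" "\<theta> \<omega> \<in> X" "\<theta> \<omega> \<in> X'"
    unfolding good0_def X'_def by auto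
qed

lemma T_good:
  assumes "\<sigma> \<in> \<Gamma>" "\<omega> \<in> good"
  shows "T \<sigma> \<omega> \<in> good"
  using assms A.comp_in measurable_space[OF A.T_meas] unfolding good_def
  by (auto simp flip: A.T_comp)

lemma X'_sets: "X' \<in> sets M"
proof -
  have [measurable]: "{\<omega> \<in> space P. \<eta> (\<theta> \<omega>) = \<omega>} \<in> sets P"
    by (rule standard_borel_diagonal[OF std_P]) measurable
  note [measurable] = X(1)
  have "good0 = {\<omega> \<in> space P. \<eta> (\<theta> \<omega>) = \<omega>} \<inter> (\<theta> -` X \<inter> space P)"
    unfolding good0_def by auto
  then have [measurable]: "good0 \<in> sets P"
    using measurable_sets[OF \<theta>_meas X(1)] by auto
  have "{\<omega> \<in> space P. T \<sigma> \<omega> \<in> good0} \<in> sets P" if "\<sigma> \<in> \<Gamma>" for \<sigma>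
    using measurable_sets[OF A.T_meas[OF that] \<open>good0 \<in> sets P\<close>] by (simp add: vimage_def Int_def conj_commute)
  then have "good \<in> sets P"
    unfolding good_def using A.countable_\<Gamma> by (intro sets.sets_Collect_countable_All')
  then have "\<eta> -` good \<inter> space M \<in> sets M"
    by (rule measurable_sets[OF \<eta>_meas])
  moreover have "{x \<in> space M. \<theta> (\<eta> x) = x} \<in> sets M"
    by (rule standard_borel_diagonal[OF std]) measurable
  moreover have "X' = X \<inter> (\<eta> -` good \<inter> space M) \<inter> {x \<in> space M. \<theta> (\<eta> x) = x}"
    unfolding X'_def using sets.sets_into_space[OF X(1)] by auto
  ultimately show ?thesis using X(1) by auto
qed

lemma X'_space: "x \<in> X' \<Longrightarrow> x \<in> space M"
  using sets.sets_into_space[OF X'_sets] by blast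

text \<open>The conjugate of T \<sigma> by \<theta>, extended by the identity so that a space of
  infinite measure is handled as well.\<close>

definition lift_perm :: "('i \<Rightarrow> 'i) \<Rightarrow> 'a \<Rightarrow> 'a" where
  "lift_perm \<sigma> x = (if x \<in> X' then \<theta> (T \<sigma> (\<eta> x)) else x)"

lemma lift_perm_\<theta>: "\<omega> \<in> good \<Longrightarrow> lift_perm \<sigma> (\<theta> \<omega>) = \<theta> (T \<sigma> \<omega>)"
  using good_sub by (simp add: lift_perm_def)

lemma lift_perm_inverse:
  assumes \<sigma>: "\<sigma> \<in> \<Gamma>" and \<tau>: "\<tau> \<in> \<Gamma>" and inv: "\<And>\<omega>. T \<tau> (T \<sigma> \<omega>) = \<omega>"
  shows "lift_perm \<tau> (lift_perm \<sigma> x) = x"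
proof (cases "x \<in> X'")
  case True
  then have x: "\<eta> x \<in> good" "\<theta> (\<eta> x) = x" by (auto simp: X'_def)
  have "lift_perm \<sigma> x = \<theta> (T \<sigma> (\<eta> x))" using lift_perm_\<theta>[OF x(1)] x(2) by simp
  then show ?thesis using lift_perm_\<theta>[OF T_good[OF \<sigma> x(1)]] inv x(2) by simp
qed (simp add: lift_perm_def)

lemma lift_perm_meas: 
  assumes \<sigma>: "\<sigma> \<in> \<Gamma>" shows "lift_perm \<sigma> \<in> measurable M M"
proof -
  note [measurable] = A.T_meas[OF \<sigma>] X'_sets
  show ?thesis unfolding lift_perm_def by measurable
qed

text \<open>Outside \<open>X'\<close> nothing moves. Inside, \<open>emeasure_\<theta>\<close> turns
  measures into probabilities on P, where T \<sigma> preserves them. The two parts are added, never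
  subtracted, so infinite values are harmless.\<close>

lemma lift_perm_distr:
  assumes \<sigma>: "\<sigma> \<in> \<Gamma>" shows "distr M M (lift_perm \<sigma>) = M"
proof (rule measure_eqI)
  fix C assume "C \<in> sets (distr M M (lift_perm \<sigma>))"
  then have C: "C \<in> sets M" by simp
  let ?D = "lift_perm \<sigma> -` C \<inter> space M"
  have D: "?D \<in> sets M" using lift_perm_meas[OF \<sigma>] C by (rule measurable_sets)
  have X'X: "X' \<subseteq> X" unfolding X'_def by auto
  have split: "emeasure M E = emeasure M (E \<inter> X') + emeasure M (E - X')" if "E \<in> sets M" for E
  proof -
    have "emeasure M (E \<inter> X') + emeasure M (E - X') = emeasure M ((E \<inter> X') \<union> (E - X'))"
      using that X'_sets by (intro plus_emeasure) auto
    then show ?thesis by (simp add: Int_Diff_Un)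
  qed
  have meas: "\<theta> -` (E \<inter> X') \<inter> space P \<in> sets P" if "E \<in> sets M" for E
    using measurable_sets[OF \<theta>_meas, of "E \<inter> X'"] that X'_sets by auto
  have "emeasure P (\<theta> -` (?D \<inter> X') \<inter> space P) = emeasure P (T \<sigma> -` (\<theta> -` (C \<inter> X') \<inter> space P) \<inter> space P)"
  proof (rule emeasure_eq_AE)
    show "AE \<omega> in P. \<omega> \<in> \<theta> -` (?D \<inter> X') \<inter> space P \<longleftrightarrow> \<omega> \<in> T \<sigma> -` (\<theta> -` (C \<inter> X') \<inter> space P) \<inter> space P"
      using AE_good
    proof eventually_elim
      case (elim \<omega>)
      then show ?case
        using lift_perm_\<theta>[OF elim, of \<sigma>] good_sub[OF elim] good_sub[OF T_good[OF \<sigma> elim]] X'_space by auto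
    qed
    show "\<theta> -` (?D \<inter> X') \<inter> space P \<in> sets P" by (rule meas[OF D])
    show "T \<sigma> -` (\<theta> -` (C \<inter> X') \<inter> space P) \<inter> space P \<in> sets P"
      using A.T_meas[OF \<sigma>] meas[OF C] by (rule measurable_sets)
  qed
  also have "\<dots> = emeasure P (\<theta> -` (C \<inter> X') \<inter> space P)"
    using A.prob_T[OF \<sigma> meas[OF C]] by (simp add: A.emeasure_eq_measure)
  finally have "emeasure M (?D \<inter> X') = emeasure M (C \<inter> X')"
    using D C X'_sets X'X by (subst (1 2) emeasure_\<theta>) auto
  moreover have "?D - X' = C - X'"
    using sets.sets_into_space[OF C] by (auto simp: lift_perm_def)
  ultimately have "emeasure M ?D = emeasure M C"
    using split[OF D] split[OF C] by simp
  then show "emeasure (distr M M (lift_perm \<sigma>)) C = emeasure M C"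
    using C lift_perm_meas[OF \<sigma>] by (simp add: emeasure_distr)
qed simp

lemma lift_to_automorphism:
  assumes \<sigma>: "\<sigma> \<in> \<Gamma>"
  obtains h where "h \<in> borel_automorphisms M" "AE \<omega> in P. h (\<theta> \<omega>) = \<theta> (T \<sigma> \<omega>)"
proof
  note inv = A.inv_in[OF \<sigma>]
  have c1: "lift_perm (inv_into UNIV \<sigma>) (lift_perm \<sigma> x) = x" and c2: "lift_perm \<sigma> (lift_perm (inv_into UNIV \<sigma>) x) = x" for x
    using A.T_inv[OF \<sigma>] by (auto intro: lift_perm_inverse[OF \<sigma> inv] lift_perm_inverse[OF inv \<sigma>])
  show "restrict (lift_perm \<sigma>) (space M) \<in> borel_automorphisms M"
  proof (rule borel_automorphismsI)
    show "bij_betw (lift_perm \<sigma>) (space M) (space M)"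
      using measurable_space[OF lift_perm_meas[OF \<sigma>]] measurable_space[OF lift_perm_meas[OF inv]] c1 c2
      by (intro bij_betw_byWitness[where f' = "lift_perm (inv_into UNIV \<sigma>)"]) auto
  qed (auto intro: lift_perm_meas lift_perm_distr \<sigma> inv c2)
  show "AE \<omega> in P. restrict (lift_perm \<sigma>) (space M) (\<theta> \<omega>) = \<theta> (T \<sigma> \<omega>)"
    using AE_good by eventually_elim (use lift_perm_\<theta> good_sub(1) \<theta>_space in auto)
qed

text \<open>Taking the inverse turns left multiplication of automorphisms into a change of the
  argument.\<close>

definition lab :: "('a \<Rightarrow> 'a) \<Rightarrow> 'b \<Rightarrow> real" where
  "lab f \<omega> = \<rho> (aut_inv M f (\<theta> \<omega>))"

lemma lab_meas[measurable]: "f \<in> borel_automorphisms M \<Longrightarrow> lab f \<in> borel_measurable P"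
  unfolding lab_def using measurable_compose[OF \<theta>_meas measurable_compose[OF borel_automorphisms_bij(2)[OF aut_inv(1)] \<rho>(1)]] .

text \<open>Freeness separates \<omega> from T \<pi> \<omega>, and \<theta> (almost everywhere), the
  inverse of f and \<rho> are all injective.\<close>

lemma lab_in_W:
  assumes f: "f \<in> borel_automorphisms M"
  shows "lab f \<in> A.W"
  unfolding A.W_def
proof (intro CollectI conjI lab_meas[OF f] ballI impI)
  fix \<pi> assume \<pi>: "\<pi> \<in> \<Gamma>" "\<pi> \<noteq> id"
  have "AE \<omega> in P. \<eta> (\<theta> (T \<pi> \<omega>)) = T \<pi> \<omega>" using A.AE_T[OF \<pi>(1) AE_\<eta>_\<theta>] .
  then show "AE \<omega> in P. lab f (T \<pi> \<omega>) \<noteq> lab f \<omega>"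
    using AE_\<eta>_\<theta> free[OF \<pi>] AE_space
  proof eventually_elim
    case (elim \<omega>)
    have sp: "\<theta> \<omega> \<in> space M" "\<theta> (T \<pi> \<omega>) \<in> space M"
      using elim \<theta>_space measurable_space[OF A.T_meas[OF \<pi>(1)]] by auto
    have "\<theta> (T \<pi> \<omega>) \<noteq> \<theta> \<omega>" using elim by metis
    then have "aut_inv M f (\<theta> (T \<pi> \<omega>)) \<noteq> aut_inv M f (\<theta> \<omega>)"
      using aut_inv(3)[OF f] sp by metis
    moreover have "aut_inv M f x \<in> space M" if "x \<in> space M" for x
      using measurable_space[OF borel_automorphisms_bij(2)[OF aut_inv(1)[OF f]] that] .
    ultimately show ?case
      unfolding lab_def using \<rho>(2) sp by (metis inj_onD)
  qed
qed

lemma prob_reach_cong: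
  assumes "w \<in> borel_measurable P" "v \<in> borel_measurable P" "AE \<omega> in P. w \<omega> = v \<omega>"
  shows "A.prob (A.reach i w B) = A.prob (A.reach i v B)"
proof -
  have "A.prob {\<omega> \<in> space P. w \<omega> \<noteq> v \<omega>} = 0" "A.prob {\<omega> \<in> space P. v \<omega> \<noteq> w \<omega>} = 0"
    using assms by (auto intro!: A.prob_eq_0_AE elim: AE_mp)
  then show ?thesis
    using A.prob_reach_local[OF assms(1,2), of i B] A.prob_reach_local[OF assms(2,1), of i B] by simp
qed

text \<open>Evaluate the equality of f and g at the preimage of x under f; the inverse of f pulls
  null sets back to null sets.\<close>

lemma AE_aut_inv_cong:
  assumes f: "f \<in> borel_automorphisms M" and g: "g \<in> borel_automorphisms M" and ae: "AE x in M. f x = g x"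
  shows "AE x in M. aut_inv M f x = aut_inv M g x"
proof -
  have "AE x in M. f (aut_inv M f x) = g (aut_inv M f x)"
    using aut_inv(1)[OF f] ae by (rule AE_borel_automorphism)
  then show ?thesis
    using AE_space
  proof eventually_elim
    case (elim x)
    have "aut_inv M f x \<in> space M"
      using measurable_space[OF borel_automorphisms_bij(2)[OF aut_inv(1)[OF f]] elim(2)] .
    then show ?case using elim aut_inv(2)[OF g] aut_inv(3)[OF f] by metis
  qed
qed

lemma lab_cong:
  assumes "f \<in> borel_automorphisms M" "g \<in> borel_automorphisms M" "AE x in M. f x = g x"
  shows "AE \<omega> in P. lab f \<omega> = lab g \<omega>"
proof -
  have "AE \<omega> in P. aut_inv M f (\<theta> \<omega>) = aut_inv M g (\<theta> \<omega>)"
    using AE_aut_inv_cong[OF assms] by (intro AE_\<theta>) auto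
  then show ?thesis by eventually_elim (simp add: lab_def)
qed

lemma aut_inv_compose:
  assumes f: "f \<in> borel_automorphisms M" and g: "g \<in> borel_automorphisms M" and x: "x \<in> space M"
  shows "aut_inv M (compose (space M) f g) x = aut_inv M g (aut_inv M f x)"
proof -
  let ?y = "aut_inv M g (aut_inv M f x)"
  note inv_space = measurable_space[OF borel_automorphisms_bij(2)[OF aut_inv(1)]]
  have sp: "aut_inv M f x \<in> space M" "?y \<in> space M"
    by (intro inv_space f g x)+
  have "compose (space M) f g ?y = x"
    using sp aut_inv(3)[OF g sp(1)] aut_inv(3)[OF f x] by (simp add: compose_def)
  then show ?thesis
    using aut_inv(2)[OF borel_automorphisms_compose[OF f g] sp(2)] by simp
qed

text \<open>The law of the random label, pushed to the index type by evaluation at i and applied to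
  B.\<close>

definition weight :: "'i \<Rightarrow> 'i set \<Rightarrow> ('a \<Rightarrow> 'a) set \<Rightarrow> real" where
  "weight i B S = (if S \<in> carrier (Aut M) then A.prob (A.reach i (lab (aut_rep S)) B) else 0)"

lemma weight_class:
  assumes f: "f \<in> borel_automorphisms M"
  shows "weight i B (aut_class M f) = A.prob (A.reach i (lab f) B)"
proof -
  let ?f = "aut_rep (aut_class M f)"
  have "?f \<in> borel_automorphisms M" by (rule aut_rep(1)[OF aut_class_in[OF f]])
  then have "A.prob (A.reach i (lab ?f) B) = A.prob (A.reach i (lab f) B)"
    using f AE_aut_rep[OF f] by (intro prob_reach_cong lab_meas lab_cong)
  then show ?thesis using aut_class_in[OF f] by (simp add: weight_def)
qed

text \<open>The inverses of s u and t u can differ at \<theta> \<omega> only if s and t disagree at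
  the preimage of \<theta> \<omega> under t. The bound does not involve u, and this is the
  uniformity required of members of \<open>E\<close>.\<close>

lemma weight_diff:
  assumes s: "s \<in> borel_automorphisms M" and t: "t \<in> borel_automorphisms M" and u: "u \<in> borel_automorphisms M"
  shows "\<bar>weight i B (aut_class M s \<otimes>\<^bsub>Aut M\<^esub> aut_class M u) - weight i B (aut_class M t \<otimes>\<^bsub>Aut M\<^esub> aut_class M u)\<bar>
    \<le> measure (distr P M (\<lambda>\<omega>. aut_inv M t (\<theta> \<omega>))) (disagree s t)"
proof -
  let ?c = "compose (space M)"
  note cs = borel_automorphisms_compose[OF s u] and ct = borel_automorphisms_compose[OF t u]
  have meas: "(\<lambda>\<omega>. aut_inv M t (\<theta> \<omega>)) \<in> measurable P M"
    using measurable_compose[OF \<theta>_meas borel_automorphisms_bij(2)[OF aut_inv(1)[OF t]]] .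
  have sub: "{\<omega> \<in> space P. lab (?c s u) \<omega> \<noteq> lab (?c t u) \<omega>} \<subseteq> (\<lambda>\<omega>. aut_inv M t (\<theta> \<omega>)) -` disagree s t \<inter> space P"
  proof
    fix \<omega> assume "\<omega> \<in> {\<omega> \<in> space P. lab (?c s u) \<omega> \<noteq> lab (?c t u) \<omega>}"
    then have \<omega>: "\<omega> \<in> space P" "lab (?c s u) \<omega> \<noteq> lab (?c t u) \<omega>" by auto
    let ?y = "aut_inv M t (\<theta> \<omega>)"
    have sp: "\<theta> \<omega> \<in> space M" "?y \<in> space M"
      using \<theta>_space[OF \<omega>(1)] measurable_space[OF meas \<omega>(1)] by auto
    have "aut_inv M s (\<theta> \<omega>) \<noteq> ?y"
      using \<omega> sp s t u by (auto simp: lab_def aut_inv_compose)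
    moreover have "aut_inv M s (s ?y) = ?y" using aut_inv(2)[OF s sp(2)] .
    ultimately have "s ?y \<noteq> \<theta> \<omega>" by metis
    moreover have "t ?y = \<theta> \<omega>" using aut_inv(3)[OF t sp(1)] .
    ultimately show "\<omega> \<in> (\<lambda>\<omega>. aut_inv M t (\<theta> \<omega>)) -` disagree s t \<inter> space P"
      using sp \<omega>(1) by (simp add: disagree_def)
  qed
  have "A.prob {\<omega> \<in> space P. lab (?c s u) \<omega> \<noteq> lab (?c t u) \<omega>} \<le>
      A.prob ((\<lambda>\<omega>. aut_inv M t (\<theta> \<omega>)) -` disagree s t \<inter> space P)"
    using sub measurable_sets[OF meas disagree_sets[OF s t]] by (rule A.finite_measure_mono)
  also have "\<dots> = measure (distr P M (\<lambda>\<omega>. aut_inv M t (\<theta> \<omega>))) (disagree s t)"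
    using measure_distr[OF meas disagree_sets[OF s t]] by simp
  finally have le: "A.prob {\<omega> \<in> space P. lab (?c s u) \<omega> \<noteq> lab (?c t u) \<omega>} \<le>
      measure (distr P M (\<lambda>\<omega>. aut_inv M t (\<theta> \<omega>))) (disagree s t)" .
  have "{\<omega> \<in> space P. lab (?c t u) \<omega> \<noteq> lab (?c s u) \<omega>} = {\<omega> \<in> space P. lab (?c s u) \<omega> \<noteq> lab (?c t u) \<omega>}"
    by auto
  then show ?thesis
    using le A.prob_reach_local[OF lab_meas[OF cs] lab_meas[OF ct], of i B]
      A.prob_reach_local[OF lab_meas[OF ct] lab_meas[OF cs], of i B]
    by (simp add: Aut_mult s t u weight_class[OF cs] weight_class[OF ct])
qed

text \<open>The law of the preimage of \<theta> \<omega> under t is absolutely continuous with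
  respect to \<nu>, so a small \<nu>-disagreement is small for it too. The resulting \<delta>
  depends on t.\<close>

lemma weight_in_E: "weight i B \<in> E"
  unfolding left_unif_cont_def
proof (intro CollectI conjI ballI allI impI)
  show "\<exists>K. \<forall>S\<in>carrier (Aut M). \<bar>weight i B S\<bar> \<le> K"
    by (intro exI[of _ 1]) (auto simp: weight_def)
  fix S and \<epsilon> :: real assume S: "S \<in> carrier (Aut M)" and \<epsilon>: "\<epsilon> > 0"
  then obtain t where t: "t \<in> borel_automorphisms M" "S = aut_class M t" by (metis Aut_cases)
  let ?L = "distr P M (\<lambda>\<omega>. aut_inv M t (\<theta> \<omega>))"
  have meas: "(\<lambda>\<omega>. aut_inv M t (\<theta> \<omega>)) \<in> measurable P M"
    using measurable_compose[OF \<theta>_meas borel_automorphisms_bij(2)[OF aut_inv(1)[OF t(1)]]] .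
  have "null_sets \<nu> \<subseteq> null_sets ?L"
  proof
    fix C assume "C \<in> null_sets \<nu>"
    then have C: "C \<in> null_sets M" "C \<in> sets M" using equivalent by (auto simp: equivalent_prob_def)
    then have "AE x in M. x \<notin> C" by (intro AE_not_in)
    then have "AE x in M. aut_inv M t x \<notin> C"
      by (rule AE_borel_automorphism[OF aut_inv(1)[OF t(1)]])
    then have "AE \<omega> in P. aut_inv M t (\<theta> \<omega>) \<notin> C"
      by (intro AE_\<theta>) auto
    then have "AE x in ?L. x \<notin> C"
      using C(2) by (subst AE_distr_iff[OF meas]) auto
    then show "C \<in> null_sets ?L"
      using C(2) AE_iff_null_sets[of C ?L] by simp
  qed
  moreover have "finite_measure ?L"
    using A.prob_space_distr[OF meas] by (simp add: prob_space_def)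
  ultimately obtain \<delta> where \<delta>: "\<delta> > 0" "\<And>C. C \<in> sets \<nu> \<Longrightarrow> measure \<nu> C < \<delta> \<Longrightarrow> measure ?L C < \<epsilon>"
    using absolutely_continuous_epsilon_delta[of ?L \<nu> \<epsilon>] \<nu>.finite_measure_axioms \<epsilon> sets_\<nu> by auto
  show "\<exists>U. openin (uniform_topology M \<nu>) U \<and> S \<in> U \<and> (\<forall>R\<in>U. \<forall>Q\<in>carrier (Aut M).
      \<bar>weight i B (R \<otimes>\<^bsub>Aut M\<^esub> Q) - weight i B (S \<otimes>\<^bsub>Aut M\<^esub> Q)\<bar> \<le> \<epsilon>)"
  proof (intro exI conjI ballI)
    show "openin (uniform_topology M \<nu>) (mball S \<delta>)" by (simp add: uniform_topology_def)
    show "S \<in> mball S \<delta>" using S \<delta> by simp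
    fix R Q assume R: "R \<in> mball S \<delta>" and Q: "Q \<in> carrier (Aut M)"
    then obtain s u where su: "s \<in> borel_automorphisms M" "R = aut_class M s" "u \<in> borel_automorphisms M" "Q = aut_class M u"
      by (metis Aut_cases in_mball)
    have "uniform_dist \<nu> R S < \<delta>" using R by (simp add: commute)
    then have "measure \<nu> (disagree s t) < \<delta>" using su t by (simp add: uniform_dist_class)
    then have "measure ?L (disagree s t) < \<epsilon>"
      using \<delta>(2) disagree_sets[OF su(1) t(1)] sets_\<nu> by simp
    then show "\<bar>weight i B (R \<otimes>\<^bsub>Aut M\<^esub> Q) - weight i B (S \<otimes>\<^bsub>Aut M\<^esub> Q)\<bar> \<le> \<epsilon>"
      using weight_diff[OF su(1) t(1) su(3), of i B] su t by simp
  qed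
qed

text \<open>The lift enters through its inverse k: the inverse of k s is the inverse of s after h,
  and h (\<theta> \<omega>) = \<theta> (T \<sigma> \<omega>) turns the label function into its shift
  by \<sigma>.\<close>

lemma weight_shift:
  assumes h: "h \<in> borel_automorphisms M" "AE \<omega> in P. h (\<theta> \<omega>) = \<theta> (T \<sigma> \<omega>)" and \<sigma>: "\<sigma> \<in> \<Gamma>"
    and S: "S \<in> carrier (Aut M)"
  shows "weight i B (aut_class M (aut_inv M h) \<otimes>\<^bsub>Aut M\<^esub> S) = weight i (\<sigma> -` B) S"
proof -
  obtain s where s: "s \<in> borel_automorphisms M" "S = aut_class M s" using S by (rule Aut_cases)
  let ?k = "aut_inv M h"
  have k: "?k \<in> borel_automorphisms M" by (rule aut_inv(1)[OF h(1)])
  have kk: "aut_inv M ?k x = h x" if "x \<in> space M" for x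
    using aut_inv(2)[OF k, of "h x"] aut_inv(2)[OF h(1) that] measurable_space[OF borel_automorphisms_bij(2)[OF h(1)] that]
    by simp
  note c = borel_automorphisms_compose[OF k s(1)]
  have shift: "(\<lambda>\<omega>. lab s (T \<sigma> \<omega>)) \<in> borel_measurable P"
    using measurable_compose[OF A.T_meas[OF \<sigma>] lab_meas[OF s(1)]] .
  have "AE \<omega> in P. lab (compose (space M) ?k s) \<omega> = lab s (T \<sigma> \<omega>)"
    using h(2) AE_space by eventually_elim (use \<theta>_space kk in \<open>auto simp: lab_def aut_inv_compose[OF k s(1)]\<close>)
  then have "A.prob (A.reach i (lab (compose (space M) ?k s)) B) = A.prob (A.reach i (\<lambda>\<omega>. lab s (T \<sigma> \<omega>)) B)"
    by (rule prob_reach_cong[OF lab_meas[OF c] shift])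
  also have "\<dots> = A.prob (A.reach i (lab s) (\<sigma> -` B))"
    by (rule A.prob_reach_shift[OF lab_meas[OF s(1)] \<sigma>])
  finally show ?thesis
    by (simp add: s Aut_mult k weight_class[OF c] weight_class[OF s(1)])
qed

theorem amenable_imp_invariant_finitely_additive:
  assumes am: "amenable (Aut M) (uniform_topology M \<nu>)"
  obtains a :: "'i set \<Rightarrow> real"
  where "a UNIV = 1" "\<And>B C. B \<inter> C = {} \<Longrightarrow> a (B \<union> C) = a B + a C"
    "\<And>\<sigma> B. \<sigma> \<in> \<Gamma> \<Longrightarrow> a (\<sigma> -` B) = a B"
proof -
  obtain m where m: "m \<in> means (Aut M) (uniform_topology M \<nu>)"
    and inv: "\<And>g f. g \<in> carrier (Aut M) \<Longrightarrow> f \<in> E \<Longrightarrow> m (\<lambda>x. f (g \<otimes>\<^bsub>Aut M\<^esub> x)) = m f"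
    using amenable_imp_invariant_mean[OF am] by blast
  have cong: "m f = m f'" if "f \<in> E" "f' \<in> E" "\<And>x. x \<in> carrier (Aut M) \<Longrightarrow> f x = f' x" for f f'
    using means_dist[OF m that(1,2), of 0] that(3) by simp
  \<comment> \<open>Any index will do; it turns random permutations into random indices.\<close>
  fix i :: 'i
  show thesis
  proof (rule that[of "\<lambda>B. m (weight i B)"])
    have "weight i UNIV S = 1" if "S \<in> carrier (Aut M)" for S
      using A.prob_reach_UNIV[OF lab_in_W[OF aut_rep(1)[OF that]], of i] that by (simp add: weight_def)
    then have "m (weight i UNIV) = m (\<lambda>_. 1)"
      by (intro cong weight_in_E const_in_E) auto
    then show "m (weight i UNIV) = 1" using means_one[OF m] by simp
  next
    fix B C :: "'i set" assume BC: "B \<inter> C = {}"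
    have "weight i (B \<union> C) S = weight i B S + weight i C S" for S
      using A.prob_reach_Un[OF lab_meas[OF aut_rep(1)] BC, of S i] by (simp add: weight_def)
    then have "weight i (B \<union> C) = (\<lambda>S. weight i B S + weight i C S)" by auto
    then show "m (weight i (B \<union> C)) = m (weight i B) + m (weight i C)"
      using means_add[OF m weight_in_E weight_in_E, of i B i C] by simp
  next
    fix \<sigma> and B :: "'i set" assume \<sigma>: "\<sigma> \<in> \<Gamma>"
    obtain h where h: "h \<in> borel_automorphisms M" "AE \<omega> in P. h (\<theta> \<omega>) = \<theta> (T \<sigma> \<omega>)"
      using lift_to_automorphism[OF \<sigma>] .
    have H: "aut_class M (aut_inv M h) \<in> carrier (Aut M)"
      by (rule aut_class_in[OF aut_inv(1)[OF h(1)]])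
    have "m (weight i (\<sigma> -` B)) = m (\<lambda>S. weight i B (aut_class M (aut_inv M h) \<otimes>\<^bsub>Aut M\<^esub> S))"
      using weight_shift[OF h \<sigma>] by (intro cong translate_in_E H weight_in_E) auto
    also have "\<dots> = m (weight i B)"
      using H weight_in_E by (rule inv)
    finally show "m (weight i (\<sigma> -` B)) = m (weight i B)" .
  qed
qed

end

section \<open>Null points and the final contradiction\<close>

lemma nonatomic_singleton:
  assumes na: "nonatomic M" and x: "{x} \<in> sets M"
  shows "emeasure M {x} = 0"
proof (rule ccontr)
  assume "emeasure M {x} \<noteq> 0"
  then obtain B where "B \<subseteq> {x}" "0 < emeasure M B" "emeasure M B < emeasure M {x}"
    using na x unfolding nonatomic_def by (metis not_gr_zero)
  then show False by (metis emeasure_empty less_irrefl subset_singleton_iff)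
qed

lemma standard_borel_singleton:
  assumes std: "standard_borel M" and x: "x \<in> space M"
  shows "{x} \<in> sets M"
proof -
  have "{y \<in> space M. y = x} \<in> sets M"
    using x by (intro standard_borel_diagonal[OF std]) auto
  moreover have "{y \<in> space M. y = x} = {x}" using x by auto
  ultimately show ?thesis by simp
qed

theorem theorem2p3:
  fixes M \<nu> :: "'a measure"
  assumes "standard_borel M"
    and "sigma_finite_measure M"
    and "emeasure M (space M) \<noteq> 0"
    and "nonatomic M"
    and "equivalent_prob M \<nu>"
  shows "\<not> amenable (Aut M) (uniform_topology M \<nu>)"
proof
  assume am: "amenable (Aut M) (uniform_topology M \<nu>)"
  interpret sigma_finite_measure M by fact
  interpret borel_aut M \<nu> by standard (use assms in auto)
  obtain F :: "nat \<Rightarrow> 'a set" where F: "range F \<subseteq> sets M" "(\<Union>n. F n) = space M" "\<And>n. emeasure M (F n) \<noteq> \<infinity>"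
    using sigma_finite by metis
  have "\<exists>n. emeasure M (F n) \<noteq> 0"
  proof (rule ccontr)
    assume "\<nexists>n. emeasure M (F n) \<noteq> 0"
    then have "(\<Union>n. F n) \<in> null_sets M" using F(1) by (intro null_sets_UN) auto
    then show False using F(2) assms(3) by auto
  qed
  then obtain X where X: "X \<in> sets M" "emeasure M X \<noteq> 0" "emeasure M X \<noteq> \<infinity>"
    using F by blast
  let ?m = "uniform_measure M X"
  have std: "standard_borel ?m"
    using assms(1) by (simp add: standard_borel_def)
  have "prob_space ?m" using X by (intro prob_space_uniform_measure) auto
  moreover have "measure ?m {x} = 0" if x: "x \<in> space ?m" for x
  proof -
    have 1: "{x} \<in> sets M" using x standard_borel_singleton[OF assms(1)] by simp
    have "emeasure M (X \<inter> {x}) \<le> emeasure M {x}" using 1 by (intro emeasure_mono) auto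
    then have "emeasure M (X \<inter> {x}) = 0" using nonatomic_singleton[OF assms(4) 1] by simp
    then show ?thesis using 1 X by (simp add: measure_def)
  qed
  ultimately obtain f g where fg: "ae_iso ?m uniform01 f g" "ae_iso uniform01 ?m g f"
    using ae_iso_standard_uniform01[OF std] by metis
  obtain f' g' where fg': "ae_iso bernoulli uniform01 f' g'" "ae_iso uniform01 bernoulli g' f'"
    using ae_iso_standard_uniform01[OF standard_borel_bernoulli bernoulli.prob_space_axioms bernoulli_singleton] by metis
  have "space M \<noteq> {}" using assms(3) by auto
  then obtain \<rho> :: "'a \<Rightarrow> real" and \<kappa> :: "real \<Rightarrow> 'a" where \<rho>: "\<rho> \<in> borel_measurable M"
    and \<kappa>: "\<And>x. x \<in> space M \<Longrightarrow> \<kappa> (\<rho> x) = x"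
    using standard_borel_embedding[OF assms(1)] by blast
  \<comment> \<open>The parametrisation of \<open>X\<close> by the product space passes through the
    unit interval, to which both are isomorphic.\<close>
  interpret bernoulli_factor M \<nu> bernoulli perms "\<lambda>\<sigma> \<omega>. \<omega> \<circ> \<sigma>" "g \<circ> f'" "g' \<circ> f" X \<rho>
  proof
    show "inj_on \<rho> (space M)" using \<kappa> by (metis inj_onI)
  qed (use X \<rho> standard_borel_bernoulli shift_free ae_iso_trans[OF fg'(1) fg(2)] in auto)
  obtain a :: "nat set \<Rightarrow> real" where a: "a UNIV = 1" "\<And>B C. B \<inter> C = {} \<Longrightarrow> a (B \<union> C) = a B + a C"
    "\<And>\<sigma> B. \<sigma> \<in> perms \<Longrightarrow> a (\<sigma> -` B) = a B"
    using amenable_imp_invariant_finitely_additive[OF am] by blast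
  let ?A = "\<lambda>j. {n::nat. n mod 3 = j}"
  have "a (?A 0) + a (- ?A 0) = 1"
    using a(2)[of "?A 0" "- ?A 0"] a(1) by simp
  then have half: "2 * a (?A 0) = 1"
    using a(3)[OF flip_in_perms, of "?A 0"] flip_vimage by simp
  \<comment> \<open>By \<open>flip\<close> the multiples of 3 have mass 1/2, and by
    \<open>turn\<close> so does each other residue class. The complement would then have mass 1,
    whereas total mass 1 leaves it only 1/2.\<close>
  have "a (?A 2) = a (?A 0)" "a (?A 1) = a (?A 2)"
    using a(3)[OF turn_in_perms] turn_vimage by metis+
  moreover have "- ?A 0 = ?A 1 \<union> ?A 2" by auto
  then have "a (- ?A 0) = a (?A 1) + a (?A 2)"
    using a(2)[of "?A 1" "?A 2"] by (simp add: disjoint_iff)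
  ultimately show False
    using half \<open>a (?A 0) + a (- ?A 0) = 1\<close> by simp
qed

end
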